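(* Let $\dot x=f(x,\mu)$, $x\in\mathbb R^n$, be a smooth one-parameter family of systems undergoing a supercritical Hopf bifurcation at $\mu=\mu_c$, with the parameter oriented so that the stable periodic branch exists for $\mu>\mu_c$. For $\mu$ in a neighborhood $J$ of $\mu_c$, let $A_\mu=\{x^*(\mu)\}$ (the stable equilibrium) if $\mu<\mu_c$ and $A_\mu=\Gamma_\mu$ (the stable periodic orbit) if $\mu>\mu_c$. Let $\Phi_\mu$ be the delay-coordinate map into $\mathbb R^m$ with embedding parameters $(\tau,m)$ common to all $\mu$, assume that $\Phi_\mu$ is an embedding on $A_\mu$, and put $M_\mu:=\Phi_\mu(A_\mu)\subset\mathbb R^m$. For $\mu>\mu_c$, let $P_\mu\subset M_\mu$ be a finite set with $d_H(P_\mu,M_\mu)\le\delta_\mu$, let $R_\mu:=\operatorname{rch}(M_\mu)>0$, assume $\delta_\mu<\frac12\sqrt{3/10}\,R_\mu$, and put $\eta_\mu^{\mathrm{geom}}:=2\left(\sqrt{3/10}\,R_\mu-2\delta_\mu\right)$; for $\mu<\mu_c$, let $P_\mu=M_\mu$ (a single point). Fix $\mu\in J$, $\mu\neq\mu_c$. Let $X^0_\mu\subset\mathbb R^m$ be the finite noise-free reconstruction, i.e. the set of delay vectors formed from $n_\mu$ noise-free scalar observations $x_1,\dots,x_{n_\mu}$, and let $a_\mu\geq 0$ satisfy $d_H(P_\mu,X^0_\mu)\le a_\mu$. Let $\widetilde X_\mu$ be the point cloud of delay vectors formed in the same way from the perturbed observations $x_k+\xi_k$, $k=1,\dots,n_\mu$,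 where $\xi_1,\dots,\xi_{n_\mu}$ are independent Gaussian random variables $\xi_k\sim\mathcal N(0,s_\mu^2)$. Put $q_\mu:=d_H(P_\mu,\widetilde X_\mu)$ and $\widetilde{\mathcal H}(\mu):=\mathscr H(\widetilde X_\mu)$. For any $0<\gamma<1$ define $$t_{\mu,\gamma}=s_\mu\sqrt{2\log\left(\frac{2n_\mu}{\gamma}\right)} .$$ Then $$\mathbb P\left(\max_{1\le k\le n_\mu}|\xi_k|\le t_{\mu,\gamma}\right)\ge 1-\gamma .$$ Consequently, with probability at least $1-\gamma$, $$q_\mu\le Q_{\mu,\gamma}:=a_\mu+\sqrt m\,s_\mu\sqrt{2\log\left(\frac{2n_\mu}{\gamma}\right)} ,$$ and, with probability at least $1-\gamma$, $\widetilde{\mathcal H}(\mu)\le 4Q_{\mu,\gamma}$ if $\mu<\mu_c$, while $\widetilde{\mathcal H}(\mu)\ge\eta_\mu^{\mathrm{geom}}-4Q_{\mu,\gamma}$ if $\mu>\mu_c$; in particular, if $\mu>\mu_c$ and $\eta_\mu^{\mathrm{geom}}>4Q_{\mu,\gamma}$, then with probability at least $1-\gamma$ the one-dimensional persistence diagram of $\widetilde X_\mu$ contains a nontrivial class whose persistence is bounded away from zero (it is at least $\eta_\mu^{\mathrm{geom}}-4Q_{\mu,\gamma}>0$).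
   Context: Supercritical Hopf bifurcation: as $\mu$ crosses $\mu_c$, a pair of complex conjugate eigenvalues of the Jacobian at the equilibrium crosses the imaginary axis with nonzero imaginary part, under the usual nondegeneracy conditions and with negative first Lyapunov coefficient; with the chosen orientation the equilibrium $x^*(\mu)$ is stable for $\mu<\mu_c$, and a stable periodic orbit $\Gamma_\mu$ (a simple closed curve) exists for $\mu>\mu_c$ near $\mu_c$. Delay-coordinate map: given a scalar observation of the state producing the time series $x(t;\mu)$, a delay $\tau>0$ and a dimension $m\ge1$, the delay vectors are $\Phi_\mu(t)=(x(t;\mu),x(t-\tau;\mu),\dots,x(t-(m-1)\tau;\mu))\in\mathbb R^m$; as a map on the attracting set, $\Phi_\mu$ sends a state to the vector of observations of that state evolved backward by $0,\tau,\dots,(m-1)\tau$. "Embedding" means an embedding in the sense of Takens' theorem; in particular $M_\mu$ is a single point for $\mu<\mu_c$ and an embedded simple closed curve for $\mu>\mu_c$. For finite data, each of the $m$ coordinates of each delay vector is one of the $n_\mu$ scalar observations (delays being a whole number of samples), and the perturbed delay vectors are obtained by replacing each $x_k$ by $x_k+\xi_k$. Hausdorff distance for compact $A,B\subset\mathbb R^m$: $d_H(A,B)=\max\{\sup_{a\in A}\inf_{b\in B}\|a-b\|,\ \sup_{b\in B}\inf_{a\in A}\|a-b\|\}$, with the Euclidean norm. Reach: for compact $K\subset\mathbb R^m$, $\operatorname{rch}(K)$ is the supremum of the $r>0$ such that every point at distance less than $r$ from $K$ has a unique nearest point in $K$. Vietoris--Rips complex: for finite $Y\subset\mathbb R^m$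 and $\varepsilon\ge0$, $\mathrm{VR}(Y,\varepsilon)$ is the simplicial complex whose simplices are the nonempty subsets of $Y$ with all pairwise Euclidean distances at most $\varepsilon$. Homology is taken with coefficients in $\mathbb F_2$. $D^{(1)}(Y)=\{(b_i,d_i)\}$ is the degree-one persistence diagram of the filtration $\{\mathrm{VR}(Y,\varepsilon)\}_{\varepsilon\ge0}$, and the persistence of a point $(b,d)$ is $d-b$. Dominant topological functional: $\mathscr H(Y):=\max_{(b,d)\in D^{(1)}(Y)}(d-b)$, with $\mathscr H(Y)=0$ if $D^{(1)}(Y)$ has no off-diagonal points. *)

theory Defs
  imports
    "HOL-Probability.Probability"
    "HOL-Library.Poly_Mapping"
    "HOL-Library.Z2"
    "HOL-Computational_Algebra.Polynomial"
begin

text \<open>The next two definitions are meant for open \<open>S\<close>.\<close>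

primrec Ck_on ::
  "nat \<Rightarrow> 'a::euclidean_space set \<Rightarrow> ('a \<Rightarrow> 'b::euclidean_space) \<Rightarrow> bool" where
  "Ck_on 0 S f \<longleftrightarrow> continuous_on S f"
| "Ck_on (Suc k) S f \<longleftrightarrow>
     (\<forall>x\<in>S. f differentiable (at x)) \<and>
     (\<forall>v. Ck_on k S (\<lambda>x. frechet_derivative f (at x) v))"

definition smooth_on :: "'a::euclidean_space set \<Rightarrow> ('a \<Rightarrow> 'b::euclidean_space) \<Rightarrow> bool" where
  "smooth_on S f \<longleftrightarrow> (\<forall>k. Ck_on k S f)"

definition is_solution ::
  "('a::euclidean_space \<Rightarrow> 'a) \<Rightarrow> (real \<Rightarrow> 'a) \<Rightarrow> real set \<Rightarrow> bool" where
  "is_solution g x I \<longleftrightarrow> (\<forall>t\<in>I. (x has_vector_derivative g (x t)) (at t within I))"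

text \<open>Only meaningful at states \<open>y\<close> whose solution is defined for all times, which is the case
  for equilibria and for points on periodic orbits.\<close>

definition flow :: "('a::euclidean_space \<Rightarrow> 'a) \<Rightarrow> real \<Rightarrow> 'a \<Rightarrow> 'a" where
  "flow g t y = (THE z. \<exists>x. is_solution g x UNIV \<and> x 0 = y \<and> x t = z)"

text \<open>Asymptotic Lyapunov stability of a compact invariant set; for a periodic orbit this is
  asymptotic orbital stability.\<close>

definition asymptotically_stable :: "('a::euclidean_space \<Rightarrow> 'a) \<Rightarrow> 'a set \<Rightarrow> bool" where
  "asymptotically_stable g A \<longleftrightarrow>
     (\<forall>\<epsilon>>0. \<exists>\<delta>>0. \<forall>y. infdist y A < \<delta> \<longrightarrow>
        (\<exists>x. is_solution g x {0..} \<and> x 0 = y) \<and>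
        (\<forall>x. is_solution g x {0..} \<and> x 0 = y \<longrightarrow> (\<forall>t\<ge>0. infdist (x t) A < \<epsilon>))) \<and>
     (\<exists>\<delta>>0. \<forall>x. is_solution g x {0..} \<and> infdist (x 0) A < \<delta> \<longrightarrow>
        ((\<lambda>t. infdist (x t) A) \<longlongrightarrow> 0) at_top)"

text \<open>\<open>T\<close> is the minimal period; injectivity on one period makes the orbit a simple closed
  curve.\<close>

definition periodic_orbit :: "('a::euclidean_space \<Rightarrow> 'a) \<Rightarrow> 'a set \<Rightarrow> bool" where
  "periodic_orbit g \<Gamma> \<longleftrightarrow>
     (\<exists>x T. 0 < T \<and> is_solution g x UNIV \<and> (\<forall>t. x (t + T) = x t) \<and>
        inj_on x {0..<T} \<and> \<Gamma> = range x)"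

definition complexify :: "real^'n^'n \<Rightarrow> complex^'n^'n" where
  "complexify A = (\<chi> i j. complex_of_real (A $ i $ j))"

definition jacobian :: "(real^'n \<Rightarrow> real^'n) \<Rightarrow> real^'n \<Rightarrow> complex^'n^'n" where
  "jacobian g x = complexify (matrix (frechet_derivative g (at x)))"

definition eigenvalue :: "complex^'n^'n \<Rightarrow> complex \<Rightarrow> bool" where
  "eigenvalue A z \<longleftrightarrow> (\<exists>v. v \<noteq> 0 \<and> A *v v = z *s v)"

definition charpoly :: "complex^'n^'n \<Rightarrow> complex poly" where
  "charpoly A = det (\<chi> i j. (if i = j then [:0, 1:] else 0) - [:A $ i $ j:])"

definition simple_eigenvalue :: "complex^'n^'n \<Rightarrow> complex \<Rightarrow> bool" where
  "simple_eigenvalue A z \<longleftrightarrow> eigenvalue A z \<and> order z (charpoly A) = 1"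

definition partial_deriv :: "'n \<Rightarrow> (real^'n \<Rightarrow> real^'n) \<Rightarrow> real^'n \<Rightarrow> real^'n" where
  "partial_deriv j g x = frechet_derivative g (at x) (axis j 1)"

text \<open>The complex-multilinear extensions \<open>B\<close> and \<open>C\<close> of the second and third derivatives of
  \<open>g\<close> at \<open>x\<close>.\<close>

definition second_form ::
  "(real^'n \<Rightarrow> real^'n) \<Rightarrow> real^'n \<Rightarrow> complex^'n \<Rightarrow> complex^'n \<Rightarrow> complex^'n" where
  "second_form g x u v =
     (\<chi> i. \<Sum>j\<in>UNIV. \<Sum>k\<in>UNIV.
        complex_of_real (partial_deriv k (partial_deriv j g) x $ i) * u $ j * v $ k)"

definition third_form ::
  "(real^'n \<Rightarrow> real^'n) \<Rightarrow> real^'n \<Rightarrow> complex^'n \<Rightarrow> complex^'n \<Rightarrow> complex^'n \<Rightarrow> complex^'n" where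
  "third_form g x u v w =
     (\<chi> i. \<Sum>j\<in>UNIV. \<Sum>k\<in>UNIV. \<Sum>l\<in>UNIV.
        complex_of_real (partial_deriv l (partial_deriv k (partial_deriv j g)) x $ i)
          * u $ j * v $ k * w $ l)"

definition herm :: "complex^'n \<Rightarrow> complex^'n \<Rightarrow> complex" where
  "herm p q = (\<Sum>i\<in>UNIV. cnj (p $ i) * q $ i)"

definition cnjv :: "complex^'n \<Rightarrow> complex^'n" where
  "cnjv q = (\<chi> i. cnj (q $ i))"

text \<open>Kuznetsov's invariant formula for the first Lyapunov coefficient at an equilibrium \<open>x\<close>
  of \<open>g\<close> with a simple pair of eigenvalues \<open>\<plusminus>\<i>\<omega>\<close>. With \<open>\<langle>q,q\<rangle> = \<langle>p,q\<rangle> = 1\<close> the pair \<open>(q,p)\<close> is unique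
  up to a common phase factor, on which the value does not depend.\<close>

definition first_lyapunov_coeff ::
  "(real^'n \<Rightarrow> real^'n) \<Rightarrow> real^'n \<Rightarrow> real \<Rightarrow> real" where
  "first_lyapunov_coeff g x \<omega> =
     (THE l. \<exists>q p.
        (let A = jacobian g x; B = second_form g x; C = third_form g x; qc = cnjv q in
          A *v q = (\<i> * of_real \<omega>) *s q \<and>
          transpose A *v p = (- \<i> * of_real \<omega>) *s p \<and>
          herm q q = 1 \<and> herm p q = 1 \<and>
          l = 1 / (2 * \<omega>) * Re
            (herm p (C q q qc)
             - 2 * herm p (B q (matrix_inv A *v B q qc))
             + herm p (B qc (matrix_inv (mat (2 * \<i> * of_real \<omega>) - A) *v B q q)))))"

text \<open>The eigenvalue conditions at \<open>\<mu>\<^sub>c\<close> along the branch \<open>xs\<close> of equilibria: a simple imaginary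
  pair \<open>\<plusminus>\<i>\<omega>\<close>, the rest of the spectrum in the open left half plane, transversal crossing from
  left to right (\<open>ev\<close> is the local eigenvalue branch through \<open>\<i>\<omega>\<close>), and negative first Lyapunov
  coefficient.\<close>

definition hopf_conditions ::
  "(real^'n \<Rightarrow> real \<Rightarrow> real^'n) \<Rightarrow> real \<Rightarrow> (real \<Rightarrow> real^'n) \<Rightarrow> bool" where
  "hopf_conditions f \<mu>\<^sub>c xs \<longleftrightarrow>
     (\<exists>\<omega>>0. \<exists>ev ev'.
        simple_eigenvalue (jacobian (\<lambda>y. f y \<mu>\<^sub>c) (xs \<mu>\<^sub>c)) (\<i> * of_real \<omega>) \<and>
        (\<forall>z. eigenvalue (jacobian (\<lambda>y. f y \<mu>\<^sub>c) (xs \<mu>\<^sub>c)) z \<and>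
             z \<noteq> \<i> * of_real \<omega> \<and> z \<noteq> - \<i> * of_real \<omega> \<longrightarrow> Re z < 0) \<and>
        ev \<mu>\<^sub>c = \<i> * of_real \<omega> \<and>
        (\<forall>\<^sub>F \<mu> in nhds \<mu>\<^sub>c. eigenvalue (jacobian (\<lambda>y. f y \<mu>) (xs \<mu>)) (ev \<mu>)) \<and>
        (ev has_vector_derivative ev') (at \<mu>\<^sub>c) \<and> Re ev' > 0 \<and>
        first_lyapunov_coeff (\<lambda>y. f y \<mu>\<^sub>c) (xs \<mu>\<^sub>c) \<omega> < 0)"

text \<open>The bifurcation on the parameter neighbourhood \<open>J\<close>, with its branch \<open>xs\<close> of equilibria and
  its branch \<open>\<Gamma>\<close> of periodic orbits, which shrinks to the equilibrium as \<open>\<mu>\<close> decreases to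
  \<open>\<mu>\<^sub>c\<close>.\<close>

definition supercritical_hopf ::
  "(real^'n \<Rightarrow> real \<Rightarrow> real^'n) \<Rightarrow> real \<Rightarrow> real set \<Rightarrow> (real \<Rightarrow> real^'n)
     \<Rightarrow> (real \<Rightarrow> (real^'n) set) \<Rightarrow> bool" where
  "supercritical_hopf f \<mu>\<^sub>c J xs \<Gamma> \<longleftrightarrow>
     open J \<and> \<mu>\<^sub>c \<in> J \<and>
     smooth_on (UNIV \<times> J) (\<lambda>(x, \<mu>). f x \<mu>) \<and>
     continuous_on J xs \<and> (\<forall>\<mu>\<in>J. f (xs \<mu>) \<mu> = 0) \<and>
     hopf_conditions f \<mu>\<^sub>c xs \<and>
     (\<forall>\<mu>\<in>J. \<mu> < \<mu>\<^sub>c \<longrightarrow> asymptotically_stable (\<lambda>y. f y \<mu>) {xs \<mu>}) \<and>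
     (\<forall>\<mu>\<in>J. \<mu> > \<mu>\<^sub>c \<longrightarrow>
        periodic_orbit (\<lambda>y. f y \<mu>) (\<Gamma> \<mu>) \<and> asymptotically_stable (\<lambda>y. f y \<mu>) (\<Gamma> \<mu>)) \<and>
     (\<forall>\<epsilon>>0. \<forall>\<^sub>F \<mu> in at_right \<mu>\<^sub>c. \<Gamma> \<mu> \<subseteq> ball (xs \<mu>\<^sub>c) \<epsilon>)"

text \<open>The coordinates of \<open>real^'m\<close> are numbered \<open>0, ..., CARD('m) - 1\<close> along the order of
  \<open>'m\<close>.\<close>

definition coord_index :: "'m::{finite,linorder} \<Rightarrow> nat" where
  "coord_index i = card {j. j < i}"

definition delay_map ::
  "(real^'n \<Rightarrow> real^'n) \<Rightarrow> (real^'n \<Rightarrow> real) \<Rightarrow> real \<Rightarrow> real^'n \<Rightarrow> real^'m::{finite,linorder}" where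
  "delay_map g obs \<tau> y = (\<chi> i. obs (flow g (- (real (coord_index i) * \<tau>)) y))"

text \<open>A smooth embedding (injective immersion, homeomorphism onto the image) of an equilibrium or
  a periodic orbit \<open>A\<close> of \<open>g\<close>. The tangent line of a periodic orbit is spanned by \<open>g\<close>, so
  the immersion condition is the one along solutions; for an equilibrium it is void.\<close>

definition takens_embedding ::
  "(real^'n \<Rightarrow> real^'n) \<Rightarrow> (real^'n \<Rightarrow> real^'m) \<Rightarrow> (real^'n) set \<Rightarrow> bool" where
  "takens_embedding g \<Phi> A \<longleftrightarrow>
     (\<exists>\<Psi>. homeomorphism A (\<Phi> ` A) \<Phi> \<Psi>) \<and>
     (\<forall>x. is_solution g x UNIV \<and> range x \<subseteq> A \<and> (\<forall>t. g (x t) \<noteq> 0) \<longrightarrow>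
        smooth_on UNIV (\<Phi> \<circ> x) \<and> (\<forall>t. vector_derivative (\<Phi> \<circ> x) (at t) \<noteq> 0))"

text \<open>For a series \<open>y 1, ..., y n\<close> and a delay of \<open>L\<close> samples; the index range of the cloud is the
  one in which every delayed index lies between \<open>1\<close> and \<open>n\<close>.\<close>

definition delay_vector :: "nat \<Rightarrow> (nat \<Rightarrow> real) \<Rightarrow> nat \<Rightarrow> real^'m::{finite,linorder}" where
  "delay_vector L y k = (\<chi> i. y (k - coord_index i * L))"

definition delay_cloud :: "nat \<Rightarrow> nat \<Rightarrow> (nat \<Rightarrow> real) \<Rightarrow> (real^'m::{finite,linorder}) set" where
  "delay_cloud L n y = delay_vector L y ` {(CARD('m) - 1) * L + 1 .. n}"

text \<open>Meant for nonempty compact sets.\<close>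

definition hausdorff_dist :: "'a::metric_space set \<Rightarrow> 'a set \<Rightarrow> real" where
  "hausdorff_dist A B = max (SUP a\<in>A. infdist a B) (SUP b\<in>B. infdist b A)"

definition reach :: "'a::metric_space set \<Rightarrow> ennreal" where
  "reach K = (SUP r\<in>{r. 0 < r \<and>
     (\<forall>x. infdist x K < r \<longrightarrow> (\<exists>!y. y \<in> K \<and> dist x y = infdist x K))}. ennreal r)"

definition vietoris_rips :: "'a::metric_space set \<Rightarrow> real \<Rightarrow> 'a set set" where
  "vietoris_rips Y \<epsilon> =
     {\<sigma>. \<sigma> \<noteq> {} \<and> finite \<sigma> \<and> \<sigma> \<subseteq> Y \<and> (\<forall>x\<in>\<sigma>. \<forall>y\<in>\<sigma>. dist x y \<le> \<epsilon>)}"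

text \<open>Simplicial chains with coefficients in \<^typ>\<open>bit\<close>, the field with two elements, for which
  orientations are irrelevant.\<close>

type_synonym 'a chain = "'a set \<Rightarrow>\<^sub>0 bit"

global_interpretation f2: vector_space "\<lambda>(a::bit) (c::'a chain). Poly_Mapping.map ((*) a) c"
  defines f2_dim = f2.dim
proof
  fix a b :: bit and c d :: "'a chain"
  show "Poly_Mapping.map ((*) a) (c + d) =
      Poly_Mapping.map ((*) a) c + Poly_Mapping.map ((*) a) d"
    by (intro poly_mapping_eqI)
       (auto simp: Poly_Mapping.map.rep_eq lookup_add when_def algebra_simps)
  show "Poly_Mapping.map ((*) (a + b)) c =
      Poly_Mapping.map ((*) a) c + Poly_Mapping.map ((*) b) c"
    by (intro poly_mapping_eqI)
       (auto simp: Poly_Mapping.map.rep_eq lookup_add when_def algebra_simps)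
  show "Poly_Mapping.map ((*) a) (Poly_Mapping.map ((*) b) c) =
      Poly_Mapping.map ((*) (a * b)) c"
    by (intro poly_mapping_eqI) (auto simp: Poly_Mapping.map.rep_eq when_def algebra_simps)
  show "Poly_Mapping.map ((*) 1) c = c"
    by (intro poly_mapping_eqI) (auto simp: Poly_Mapping.map.rep_eq when_def)
qed

definition chains :: "nat \<Rightarrow> 'a set set \<Rightarrow> 'a chain set" where
  "chains p K = {c. Poly_Mapping.keys c \<subseteq> {\<sigma>\<in>K. card \<sigma> = p + 1}}"

definition boundary :: "'a chain \<Rightarrow> 'a chain" where
  "boundary c = (\<Sum>\<sigma>\<in>Poly_Mapping.keys c. if card \<sigma> \<le> 1 then 0
     else \<Sum>v\<in>\<sigma>. Poly_Mapping.single (\<sigma> - {v}) (Poly_Mapping.lookup c \<sigma>))"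

definition cycles :: "nat \<Rightarrow> 'a set set \<Rightarrow> 'a chain set" where
  "cycles p K = {c \<in> chains p K. boundary c = 0}"

definition boundaries :: "nat \<Rightarrow> 'a set set \<Rightarrow> 'a chain set" where
  "boundaries p K = boundary ` chains (p + 1) K"

text \<open>For finite \<open>Y\<close> and \<open>s \<le> t\<close>, the rank of
  \<open>H\<^sub>p (VR Y s) \<rightarrow> H\<^sub>p (VR Y t)\<close>, whose image is \<open>Z\<^sub>p (VR Y s) / (Z\<^sub>p (VR Y s) \<inter> B\<^sub>p (VR Y t))\<close>.\<close>

definition persistent_betti :: "nat \<Rightarrow> 'a::metric_space set \<Rightarrow> real \<Rightarrow> real \<Rightarrow> nat" where
  "persistent_betti p Y s t =
     f2_dim (cycles p (vietoris_rips Y s)) -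
     f2_dim (cycles p (vietoris_rips Y s) \<inter> boundaries p (vietoris_rips Y t))"

text \<open>The number of classes born exactly at \<open>b\<close> and dying exactly at \<open>d\<close>. The complexes change
  only at finitely many parameters, so the alternating sum is constant for small \<open>e > 0\<close>.\<close>

definition pd_multiplicity :: "nat \<Rightarrow> 'a::metric_space set \<Rightarrow> real \<Rightarrow> real \<Rightarrow> nat" where
  "pd_multiplicity p Y b d = (THE k. \<forall>\<^sub>F e in at_right 0. int k =
     (int (persistent_betti p Y b (d - e)) - int (persistent_betti p Y b d)) -
     (int (persistent_betti p Y (b - e) (d - e)) - int (persistent_betti p Y (b - e) d)))"

definition critical_values :: "'a::metric_space set \<Rightarrow> real set" where
  "critical_values Y = {dist x y | x y. x \<in> Y \<and> y \<in> Y}"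

text \<open>The off-diagonal points with finite death. For \<open>p \<ge> 1\<close> and finite \<open>Y\<close> there are no others:
  beyond the diameter of \<open>Y\<close> the complex is a full simplex.\<close>

definition persistence_diagram :: "nat \<Rightarrow> 'a::metric_space set \<Rightarrow> (real \<times> real) multiset" where
  "persistence_diagram p Y =
     (\<Sum>(b, d)\<in>{(b, d). b \<in> critical_values Y \<and> d \<in> critical_values Y \<and> b < d}.
        replicate_mset (pd_multiplicity p Y b d) (b, d))"

definition dominant_persistence :: "'a::metric_space set \<Rightarrow> real" where
  "dominant_persistence Y =
     (if persistence_diagram 1 Y = {#} then 0
      else Max ((\<lambda>(b, d). d - b) ` set_mset (persistence_diagram 1 Y)))"

text \<open>\<^const>\<open>normal_density\<close> is a probability density only for positive standard deviation; the
  degenerate law of variance \<open>0\<close> is the point mass.\<close>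

definition centered_normal :: "real \<Rightarrow> real measure" where
  "centered_normal s =
     (if s = 0 then return borel 0 else density lborel (\<lambda>x. ennreal (normal_density 0 s x)))"

end

theory Submission
  imports Defs "HOL-Complex_Analysis.Winding_Numbers" "HOL-Library.Periodic_Fun"
begin

text \<open>
  The argument has a deterministic half and a probabilistic one.

  On the deterministic side everything is expressed through one relation, \<open>survives Y s t\<close>: some
  class of \<open>H\<^sub>1 (VR Y s)\<close> has nonzero image in \<open>H\<^sub>1 (VR Y t)\<close>. By duality over the field with two
  elements this means that \<open>VR Y t\<close> carries a 1-cocycle whose restriction to \<open>VR Y s\<close> is not a
  coboundary (\<open>survives_iff\<close>), and cocycles are merely functions on pairs of points that can be
  pulled back along arbitrary maps. For \<open>s \<le> t\<close> the persistence diagram has a point \<open>(b, d)\<close> with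
  \<open>b \<le> s\<close> and \<open>t < d\<close> exactly when \<open>survives Y s t\<close> (\<open>survives_of_mem_diagram\<close>, \<open>mem_diagram_of_survives\<close>), so
  the dominant persistence is the supremum of \<open>t - s\<close> over the surviving pairs \<open>s \<le> t\<close>, or \<open>0\<close> if there
  are none.

  Three consequences carry the theorem.

  \<^item> Stability: pulling cocycles back along nearest-point maps shows that a cloud at Hausdorff
    distance at most \<open>q\<close> loses at most \<open>2q\<close> at either end of a surviving interval
    (\<open>survives_perturb\<close>); hence the dominant persistence changes by at most \<open>4q\<close>. Below the
    bifurcation the reference set is a point, in which nothing survives.

  \<^item> Geometry: let \<open>M\<close> be a simple closed curve such that points closer than \<open>R\<close> have a unique
    nearest point on it. The nearest-point projection followed by a homeomorphism to the circle is
    a nonvanishing complex function near \<open>M\<close>; its change of angle along segments between sample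
    points, less the difference of the principal angles at the endpoints, is a whole number of turns and
    defines a cocycle below scale \<open>sqrt 3 * R\<close>, because every point of a triangle with such sides lies
    within \<open>R\<close> of one of the vertices. Along a closed chain of samples that follows the curve it adds up to
    \<open>\<plusminus>1\<close> turn, so it is not a coboundary modulo two at any scale above \<open>2\<delta>\<close>
    (\<open>survives_curve_sample\<close>). The resulting interval is longer than
    \<open>2 * (sqrt (3/10) * R - 2 * \<delta>)\<close>.

  \<^item> Measurability: whether a class survives depends only on which pairwise distances are at most
    \<open>s\<close> and \<open>t\<close>, so the relevant events are finite or countable unions of measurable sets
    (\<open>borel_measurable_dominant_persistence\<close>).

  On the probabilistic side, the Gaussian tail estimate and a union bound give an event of probability
  at least \<open>1 - \<gamma>\<close> on which all noise terms are at most \<open>t\<close> (\<open>max_noise_bound\<close>). On that event every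
  delay vector moves by at most \<open>sqrt m * t\<close>, and the deterministic bounds hold pointwise.
\<close>

section \<open>Chains over the two-element field\<close>

text \<open>The simplifier would turn addition and multiplication on \<^typ>\<open>bit\<close> into bitwise operations,
  to which the laws of a ring do not apply.\<close>
declare add_bit_eq_xor [simp del] mult_bit_eq_and [simp del]

lemma bit_add_self [simp]: "a + a = (0::bit)" by (cases a) auto

text \<open>The evaluation of a cochain on a chain.\<close>
definition pairing :: "('a set \<Rightarrow> bit) \<Rightarrow> 'a chain \<Rightarrow> bit" where
  "pairing g c = (\<Sum>\<sigma>\<in>Poly_Mapping.keys c. g \<sigma> * Poly_Mapping.lookup c \<sigma>)"

definition face_boundary :: "'a set \<Rightarrow> 'a chain" where
  "face_boundary \<sigma> = (if card \<sigma> \<le> 1 then 0 else \<Sum>v\<in>\<sigma>. Poly_Mapping.single (\<sigma> - {v}) 1)"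

definition coboundary :: "('a set \<Rightarrow> bit) \<Rightarrow> 'a set \<Rightarrow> bit" where
  "coboundary g \<sigma> = (if card \<sigma> \<le> 1 then 0 else \<Sum>v\<in>\<sigma>. g (\<sigma> - {v}))"

lemma pairing_superset:
  assumes "finite S" "Poly_Mapping.keys c \<subseteq> S"
  shows "pairing g c = (\<Sum>\<sigma>\<in>S. g \<sigma> * Poly_Mapping.lookup c \<sigma>)"
  unfolding pairing_def using assms
  by (intro sum.mono_neutral_left) (auto simp: in_keys_iff)

lemma pairing_add: "pairing g (c + d) = pairing g c + pairing g d"
proof -
  let ?S = "Poly_Mapping.keys c \<union> Poly_Mapping.keys d"
  have "Poly_Mapping.keys (c + d) \<subseteq> ?S" by (rule Poly_Mapping.keys_add)
  then have "pairing g (c + d) = (\<Sum>\<sigma>\<in>?S. g \<sigma> * Poly_Mapping.lookup (c + d) \<sigma>)"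
    by (intro pairing_superset) auto
  also have "\<dots> = (\<Sum>\<sigma>\<in>?S. g \<sigma> * Poly_Mapping.lookup c \<sigma>) + (\<Sum>\<sigma>\<in>?S. g \<sigma> * Poly_Mapping.lookup d \<sigma>)"
    by (simp only: lookup_add distrib_left sum.distrib)
  also have "\<dots> = pairing g c + pairing g d"
    by (simp only: pairing_superset[of ?S c] pairing_superset[of ?S d] finite_UnI finite_keys Un_upper1 Un_upper2)
  finally show ?thesis .
qed

lemma pairing_0 [simp]: "pairing g 0 = 0" by (simp add: pairing_def)

lemma pairing_sum: "pairing g (sum f A) = (\<Sum>i\<in>A. pairing g (f i))"
  by (induction A rule: infinite_finite_induct) (auto simp: pairing_add)

lemma pairing_single [simp]: "pairing g (Poly_Mapping.single \<sigma> a) = g \<sigma> * a"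
  by (cases a) (auto simp: pairing_def)

lemma bit_scale_cases: "Poly_Mapping.map ((*) a) c = (if a = 0 then 0 else c)" for c :: "'a chain"
  by (cases a) (auto intro!: poly_mapping_eqI simp: Poly_Mapping.map.rep_eq when_def)

lemma chain_eq_sum_singles: "c = (\<Sum>\<sigma>\<in>Poly_Mapping.keys c. Poly_Mapping.single \<sigma> 1)"
  for c :: "'a chain"
proof (rule poly_mapping_eqI)
  fix k
  show "Poly_Mapping.lookup c k =
    Poly_Mapping.lookup (\<Sum>\<sigma>\<in>Poly_Mapping.keys c. Poly_Mapping.single \<sigma> 1) k"
    by (simp add: lookup_sum lookup_single when_def in_keys_iff)
qed

lemma boundary_eq: "boundary c = (\<Sum>\<sigma>\<in>Poly_Mapping.keys c. face_boundary \<sigma>)"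
  unfolding boundary_def face_boundary_def
  by (intro sum.cong refl) (auto simp: in_keys_iff intro!: sum.cong)

lemma chain_add_self [simp]: "c + c = 0" for c :: "'a chain"
  by (intro poly_mapping_eqI) (simp add: lookup_add)

lemma boundary_superset:
  assumes "finite S" "Poly_Mapping.keys c \<subseteq> S"
  shows "boundary c = (\<Sum>\<sigma>\<in>S. if Poly_Mapping.lookup c \<sigma> = 0 then 0 else face_boundary \<sigma>)"
  unfolding boundary_eq using assms
  by (intro sum.mono_neutral_cong_left) (auto simp: in_keys_iff)

lemma boundary_add: "boundary (c + d) = boundary c + boundary d"
proof -
  let ?S = "Poly_Mapping.keys c \<union> Poly_Mapping.keys d"
  have "Poly_Mapping.keys (c + d) \<subseteq> ?S" by (rule Poly_Mapping.keys_add)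
  moreover have "(if Poly_Mapping.lookup (c + d) \<sigma> = 0 then 0 else face_boundary \<sigma>) =
     (if Poly_Mapping.lookup c \<sigma> = 0 then 0 else face_boundary \<sigma>)
   + (if Poly_Mapping.lookup d \<sigma> = 0 then 0 else face_boundary \<sigma>)" for \<sigma>
    by (auto simp: lookup_add)
  ultimately show ?thesis
    by (simp only: boundary_superset[of ?S "c + d"] boundary_superset[of ?S c] boundary_superset[of ?S d]
      sum.distrib finite_UnI finite_keys Un_upper1 Un_upper2)
qed

lemma boundary_0 [simp]: "boundary 0 = 0" by (simp add: boundary_eq)

text \<open>The coboundary is the transpose of the boundary.\<close>
lemma pairing_boundary: "pairing g (boundary c) = pairing (coboundary g) c"
proof -
  have "pairing g (face_boundary \<sigma>) = coboundary g \<sigma>" for \<sigma>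
    by (simp add: face_boundary_def coboundary_def pairing_sum)
  then have "pairing g (boundary c) = (\<Sum>\<sigma>\<in>Poly_Mapping.keys c. coboundary g \<sigma>)"
    by (simp add: boundary_eq pairing_sum)
  also have "\<dots> = pairing (coboundary g) c"
    unfolding pairing_def by (intro sum.cong) (auto simp: in_keys_iff)
  finally show ?thesis .
qed

lemma f2_subspaceI:
  assumes "0 \<in> V" "\<And>c d. c \<in> V \<Longrightarrow> d \<in> V \<Longrightarrow> c + d \<in> V"
  shows "f2.subspace V"
  using assms by (intro f2.subspaceI) (simp_all only: bit_scale_cases split: if_split, auto)

text \<open>Extend a basis of \<open>V\<close> by \<open>z\<close> and let the functional read off the coefficient of \<open>z\<close>. Chains have
  finite support, so every functional is evaluation of a cochain.\<close>
lemma separating_functional: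
  fixes V :: "'a chain set"
  assumes "f2.subspace V" "z \<notin> V"
  obtains g where "\<And>c. c \<in> V \<Longrightarrow> pairing g c = 0" "pairing g z = 1"
proof -
  interpret bit: vector_space "(*) :: bit \<Rightarrow> bit \<Rightarrow> bit"
    by unfold_locales (auto simp: algebra_simps)
  interpret p: vector_space_pair "\<lambda>(a::bit) (c::'a chain). Poly_Mapping.map ((*) a) c"
    "(*) :: bit \<Rightarrow> bit \<Rightarrow> bit" by unfold_locales
  obtain B where B: "B \<subseteq> V" "f2.independent B" "V \<subseteq> f2.span B" "card B = f2_dim V"
    by (rule f2.basis_exists)
  have "f2.span B \<subseteq> V" using B(1) assms(1) by (rule f2.span_minimal)
  then have z: "z \<notin> f2.span B" using assms(2) by auto
  then have ind: "f2.independent (insert z B)" by (intro f2.independent_insertI B)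
  define F where "F = p.construct (insert z B) (\<lambda>b. if b = z then 1 else 0)"
  have lin: "Vector_Spaces.linear (\<lambda>(a::bit) (c::'a chain). Poly_Mapping.map ((*) a) c) (*) F"
    unfolding F_def by (rule p.linear_construct[OF ind])
  interpret F: Vector_Spaces.linear "\<lambda>(a::bit) (c::'a chain). Poly_Mapping.map ((*) a) c"
    "(*) :: bit \<Rightarrow> bit \<Rightarrow> bit" F by (rule lin)
  have Fz: "F z = 1" unfolding F_def by (subst p.construct_basis[OF ind]) auto
  have FB: "F b = 0" if "b \<in> B" for b
    using that z f2.span_base unfolding F_def by (subst p.construct_basis[OF ind]) auto
  have FV: "F c = 0" if "c \<in> V" for c
    using B(3) that FB p.linear_eq_0_on_span[OF lin, of B c] by auto
  define g where "g \<sigma> = F (Poly_Mapping.single \<sigma> 1)" for \<sigma>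
  have "F c = pairing g c" for c
  proof -
    have "F c = F (\<Sum>\<sigma>\<in>Poly_Mapping.keys c. Poly_Mapping.single \<sigma> 1)"
      using chain_eq_sum_singles[of c] by simp
    also have "\<dots> = pairing g c"
      unfolding F.sum pairing_def g_def by (intro sum.cong) (auto simp: in_keys_iff)
    finally show ?thesis .
  qed
  then show thesis using that[of g] Fz FV by simp
qed

section \<open>Persistent classes detected by cocycles\<close>

text \<open>Cochains are taken on ordered pairs of points, repetitions included. The identity for
  degenerate triples forces \<open>\<phi> x x = 0\<close> and symmetry, and thanks to it a cocycle can be pulled back along
  maps that are not injective.\<close>
definition edge_cocycle :: "'a::metric_space set \<Rightarrow> real \<Rightarrow> ('a \<Rightarrow> 'a \<Rightarrow> bit) \<Rightarrow> bool" where
  "edge_cocycle Y t \<phi> \<longleftrightarrow> (\<forall>x\<in>Y. \<forall>y\<in>Y. \<forall>z\<in>Y.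
     dist x y \<le> t \<and> dist y z \<le> t \<and> dist x z \<le> t \<longrightarrow> \<phi> x z = \<phi> x y + \<phi> y z)"

definition edge_coboundary :: "'a::metric_space set \<Rightarrow> real \<Rightarrow> ('a \<Rightarrow> 'a \<Rightarrow> bit) \<Rightarrow> bool" where
  "edge_coboundary Y s \<phi> \<longleftrightarrow>
     (\<exists>\<alpha>. \<forall>x\<in>Y. \<forall>y\<in>Y. dist x y \<le> s \<longrightarrow> \<phi> x y = \<alpha> x + \<alpha> y)"

text \<open>For finite \<open>Y\<close> and \<open>s \<le> t\<close> this says that \<open>H\<^sub>1 (VR Y s) \<rightarrow> H\<^sub>1 (VR Y t)\<close> is not zero, in the dual form
  that \<open>H\<^sup>1 (VR Y t) \<rightarrow> H\<^sup>1 (VR Y s)\<close> is not zero.\<close>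
definition survives :: "'a::metric_space set \<Rightarrow> real \<Rightarrow> real \<Rightarrow> bool" where
  "survives Y s t \<longleftrightarrow> (\<exists>\<phi>. edge_cocycle Y t \<phi> \<and> \<not> edge_coboundary Y s \<phi>)"

lemma edge_cocycleD:
  assumes "edge_cocycle Y t \<phi>" "x \<in> Y" "y \<in> Y" "z \<in> Y"
    "dist x y \<le> t" "dist y z \<le> t" "dist x z \<le> t"
  shows "\<phi> x z = \<phi> x y + \<phi> y z"
  using assms unfolding edge_cocycle_def by blast

lemma edge_cocycle_refl:
  assumes "edge_cocycle Y t \<phi>" "x \<in> Y" "0 \<le> t"
  shows "\<phi> x x = 0"
  using edge_cocycleD[OF assms(1,2,2,2)] assms(3) by simp

lemma edge_cocycle_sym:
  assumes "edge_cocycle Y t \<phi>" "x \<in> Y" "y \<in> Y" "dist x y \<le> t"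
  shows "\<phi> x y = \<phi> y x"
proof -
  have "0 \<le> t" using assms(4) zero_le_dist[of x y] by linarith
  then have "\<phi> x y + \<phi> y x = 0"
    using edge_cocycleD[OF assms(1,2,3,2)] edge_cocycle_refl[OF assms(1,2)] assms(4)
    by (simp add: dist_commute)
  then show ?thesis by (cases "\<phi> x y"; cases "\<phi> y x") auto
qed

lemma chains_subspace: "f2.subspace (chains p K)"
  using Poly_Mapping.keys_add by (intro f2_subspaceI) (fastforce simp: chains_def)+

lemma cycles_subspace: "f2.subspace (cycles p K)"
  using f2.subspace_0[OF chains_subspace, of p K] f2.subspace_add[OF chains_subspace, of _ p K]
  by (intro f2_subspaceI) (auto simp: cycles_def boundary_add)

lemma boundaries_subspace: "f2.subspace (boundaries p K)"
proof (rule f2_subspaceI)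
  show "0 \<in> boundaries p K"
    using f2.subspace_0[OF chains_subspace, of "p + 1" K] boundary_0
    unfolding boundaries_def by (metis image_eqI)
  show "c + d \<in> boundaries p K" if "c \<in> boundaries p K" "d \<in> boundaries p K" for c d
    using that f2.subspace_add[OF chains_subspace, of _ "p + 1" K]
    unfolding boundaries_def by (auto simp flip: boundary_add)
qed

lemma chains_1_keyE:
  assumes "c \<in> chains 1 (vietoris_rips Y s)" "\<sigma> \<in> Poly_Mapping.keys c"
  obtains x y where "\<sigma> = {x, y}" "x \<noteq> y" "x \<in> Y" "y \<in> Y" "dist x y \<le> s"
proof -
  have "\<sigma> \<in> vietoris_rips Y s" "card \<sigma> = 2" using assms by (auto simp: chains_def)
  then obtain x y where "\<sigma> = {x, y}" "x \<noteq> y" by (auto simp: card_2_iff)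
  with \<open>\<sigma> \<in> vietoris_rips Y s\<close> show ?thesis
    using that[of x y] by (auto simp: vietoris_rips_def)
qed

lemma chains_2_keyE:
  assumes "c \<in> chains 2 (vietoris_rips Y s)" "\<sigma> \<in> Poly_Mapping.keys c"
  obtains x y z where "\<sigma> = {x, y, z}" "x \<noteq> y" "y \<noteq> z" "x \<noteq> z" "x \<in> Y" "y \<in> Y" "z \<in> Y"
    "dist x y \<le> s" "dist y z \<le> s" "dist x z \<le> s"
proof -
  have "\<sigma> \<in> vietoris_rips Y s" "card \<sigma> = 3" using assms by (auto simp: chains_def)
  then obtain x y z where "\<sigma> = {x, y, z}" "x \<noteq> y" "y \<noteq> z" "x \<noteq> z" by (auto simp: card_3_iff)
  with \<open>\<sigma> \<in> vietoris_rips Y s\<close> show ?thesis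
    using that[of x y z] by (auto simp: vietoris_rips_def)
qed

lemma single_edge_chain:
  assumes "x \<noteq> y" "x \<in> Y" "y \<in> Y" "dist x y \<le> s"
  shows "Poly_Mapping.single {x, y} 1 \<in> chains 1 (vietoris_rips Y s)"
proof -
  have "0 \<le> s" using assms(4) zero_le_dist[of x y] by linarith
  then show ?thesis using assms by (auto simp: chains_def vietoris_rips_def dist_commute)
qed

lemma single_triangle_chain:
  assumes "x \<noteq> y" "y \<noteq> z" "x \<noteq> z" "x \<in> Y" "y \<in> Y" "z \<in> Y"
    "dist x y \<le> s" "dist y z \<le> s" "dist x z \<le> s"
  shows "Poly_Mapping.single {x, y, z} 1 \<in> chains 2 (vietoris_rips Y s)"
proof -
  have "0 \<le> s" using assms(7) zero_le_dist[of x y] by linarith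
  then show ?thesis using assms by (auto simp: chains_def vietoris_rips_def dist_commute)
qed

lemma coboundary_edge: "x \<noteq> y \<Longrightarrow> coboundary g {x, y} = g {x} + g {y}"
  by (simp add: coboundary_def insert_Diff_if add.commute)

lemma coboundary_triangle:
  assumes "x \<noteq> y" "y \<noteq> z" "x \<noteq> z"
  shows "coboundary g {x, y, z} = g {y, z} + (g {x, z} + g {x, y})"
proof -
  have "{x, y, z} - {x} = {y, z}" "{x, y, z} - {y} = {x, z}" "{x, y, z} - {z} = {x, y}"
    using assms by auto
  then show ?thesis using assms by (simp add: coboundary_def)
qed

lemma pairing_cong: "(\<And>\<sigma>. \<sigma> \<in> Poly_Mapping.keys c \<Longrightarrow> g \<sigma> = h \<sigma>) \<Longrightarrow> pairing g c = pairing h c"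
  unfolding pairing_def by (intro sum.cong) auto

lemma pairing_zero_fun [simp]: "pairing (\<lambda>_. 0) c = 0"
  by (simp add: pairing_def)

lemma boundaries_1: "boundaries 1 K = boundary ` chains 2 K"
  by (simp add: boundaries_def numeral_2_eq_2)

lemma bit_add_zeroD: "0 = a + b \<Longrightarrow> b = (a::bit)"
  by (cases a; cases b) simp_all

text \<open>A functional that separates a cycle of \<open>VR Y s\<close> from the boundaries of \<open>VR Y t\<close> is a cocycle at
  scale \<open>t\<close>; it cannot be a coboundary at scale \<open>s\<close>, since coboundaries vanish on cycles.\<close>
lemma survives_if_not_cycles_subset_boundaries:
  assumes "\<not> cycles 1 (vietoris_rips Y s) \<subseteq> boundaries 1 (vietoris_rips Y t)"
  shows "survives Y s t"
proof -
  obtain z where z: "z \<in> cycles 1 (vietoris_rips Y s)" "z \<notin> boundaries 1 (vietoris_rips Y t)"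
    using assms by auto
  obtain g where g: "\<And>c. c \<in> boundaries 1 (vietoris_rips Y t) \<Longrightarrow> pairing g c = 0" "pairing g z = 1"
    using separating_functional[OF boundaries_subspace z(2)] by blast
  define \<phi> where "\<phi> x y = (if x = y then 0 else g {x, y})" for x y
  have "edge_cocycle Y t \<phi>"
    unfolding edge_cocycle_def
  proof (intro ballI impI)
    fix x y z assume Y: "x \<in> Y" "y \<in> Y" "z \<in> Y"
      and d: "dist x y \<le> t \<and> dist y z \<le> t \<and> dist x z \<le> t"
    show "\<phi> x z = \<phi> x y + \<phi> y z"
    proof (cases "x \<noteq> y \<and> y \<noteq> z \<and> x \<noteq> z")
      case True
      have "boundary (Poly_Mapping.single {x, y, z} 1) \<in> boundaries 1 (vietoris_rips Y t)"
        using single_triangle_chain[of x y z Y t] True Y d unfolding boundaries_1 by blast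
      then have "pairing (coboundary g) (Poly_Mapping.single {x, y, z} 1) = 0"
        using g(1) pairing_boundary by metis
      then have "g {y, z} + (g {x, z} + g {x, y}) = 0"
        using True by (simp add: coboundary_triangle)
      then show ?thesis using True
        by (cases "g {x, y}"; cases "g {y, z}"; cases "g {x, z}") (auto simp: \<phi>_def)
    qed (auto simp: \<phi>_def insert_commute)
  qed
  moreover have "\<not> edge_coboundary Y s \<phi>"
  proof
    assume "edge_coboundary Y s \<phi>"
    then obtain \<alpha> where \<alpha>: "\<And>x y. x \<in> Y \<Longrightarrow> y \<in> Y \<Longrightarrow> dist x y \<le> s \<Longrightarrow> \<phi> x y = \<alpha> x + \<alpha> y"
      unfolding edge_coboundary_def by blast
    have "pairing g z = pairing (coboundary (\<lambda>\<tau>. \<alpha> (the_elem \<tau>))) z"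
    proof (rule pairing_cong)
      fix \<sigma> assume "\<sigma> \<in> Poly_Mapping.keys z"
      then obtain x y where "\<sigma> = {x, y}" "x \<noteq> y" "x \<in> Y" "y \<in> Y" "dist x y \<le> s"
        using z(1) chains_1_keyE unfolding cycles_def by blast
      then show "g \<sigma> = coboundary (\<lambda>\<tau>. \<alpha> (the_elem \<tau>)) \<sigma>"
        using \<alpha>[of x y] by (simp add: coboundary_edge \<phi>_def)
    qed
    also have "\<dots> = pairing (\<lambda>\<tau>. \<alpha> (the_elem \<tau>)) (boundary z)" by (simp add: pairing_boundary)
    also have "\<dots> = 0" using z(1) by (simp add: cycles_def)
    finally show False using g(2) by simp
  qed
  ultimately show ?thesis unfolding survives_def by blast
qed

text \<open>If every cycle of \<open>VR Y s\<close> bounded in \<open>VR Y t\<close>, a cocycle at scale \<open>t\<close> would vanish on the cycles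
  of \<open>VR Y s\<close>. It would then factor through the boundary operator there, and such a factorisation is a
  potential \<open>\<alpha>\<close>.\<close>
lemma not_cycles_subset_boundaries_if_survives:
  assumes "survives Y s t" "s \<le> t"
  shows "\<not> cycles 1 (vietoris_rips Y s) \<subseteq> boundaries 1 (vietoris_rips Y t)"
proof
  assume sub: "cycles 1 (vietoris_rips Y s) \<subseteq> boundaries 1 (vietoris_rips Y t)"
  obtain \<phi> where \<phi>: "edge_cocycle Y t \<phi>" "\<not> edge_coboundary Y s \<phi>"
    using assms(1) unfolding survives_def by blast
  define f where "f \<sigma> = (SOME b. \<exists>x y. \<sigma> = {x, y} \<and> b = \<phi> x y)" for \<sigma>
  have f: "f {x, y} = \<phi> x y" if "x \<in> Y" "y \<in> Y" "dist x y \<le> t" for x y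
    unfolding f_def using edge_cocycle_sym[OF \<phi>(1) that]
    by (intro some_equality) (auto simp: doubleton_eq_iff)
  have f_cycle: "pairing f c = 0" if c: "c \<in> cycles 1 (vietoris_rips Y s)" for c
  proof -
    have "c \<in> boundaries 1 (vietoris_rips Y t)" using sub c by (rule subsetD)
    then obtain d where d: "d \<in> chains 2 (vietoris_rips Y t)" "c = boundary d"
      unfolding boundaries_1 by (rule imageE) simp
    have "pairing f c = pairing (coboundary f) d" by (simp add: d pairing_boundary)
    also have "\<dots> = pairing (\<lambda>_. 0) d"
    proof (rule pairing_cong)
      fix \<sigma> assume "\<sigma> \<in> Poly_Mapping.keys d"
      then obtain x y z where "\<sigma> = {x, y, z}" "x \<noteq> y" "y \<noteq> z" "x \<noteq> z" "x \<in> Y" "y \<in> Y" "z \<in> Y"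
        "dist x y \<le> t" "dist y z \<le> t" "dist x z \<le> t"
        by (rule chains_2_keyE[OF d(1)])
      then show "coboundary f \<sigma> = 0"
        using edge_cocycleD[OF \<phi>(1), of x y z]
        by (cases "\<phi> x y"; cases "\<phi> y z") (auto simp: coboundary_triangle f)
    qed
    finally show ?thesis by simp
  qed
  \<comment> \<open>To factor \<open>f\<close> through the boundary, record its value on the simplex \<open>{}\<close>, which occurs in no
    boundary of an edge: a functional that vanishes on all \<open>T c\<close> and is 1 at \<open>{}\<close> agrees with \<open>f\<close> on
    the boundaries.\<close>
  define T where "T c = boundary c + Poly_Mapping.single {} (pairing f c)" for c
  have T_add: "T c + T d = T (c + d)" for c d
    by (simp only: T_def boundary_add pairing_add single_add add_ac)
  define W where "W = T ` chains 1 (vietoris_rips Y s)"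
  have "f2.subspace W"
  proof (rule f2_subspaceI)
    show "0 \<in> W" using f2.subspace_0[OF chains_subspace] unfolding W_def T_def
      by (intro image_eqI[of _ _ 0]) auto
    show "c + d \<in> W" if "c \<in> W" "d \<in> W" for c d
      using that f2.subspace_add[OF chains_subspace, of _ 1 "vietoris_rips Y s"]
      unfolding W_def by (auto simp: T_add)
  qed
  moreover have "Poly_Mapping.single {} 1 \<notin> W"
  proof
    assume "Poly_Mapping.single {} 1 \<in> W"
    then obtain c where c: "c \<in> chains 1 (vietoris_rips Y s)" "Poly_Mapping.single {} 1 = T c"
      unfolding W_def by (rule imageE) simp
    define e :: "'a set \<Rightarrow> bit" where "e \<sigma> = (if \<sigma> = {} then 1 else 0)" for \<sigma>
    have "pairing e (boundary c) = pairing (coboundary e) c" by (rule pairing_boundary)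
    also have "\<dots> = pairing (\<lambda>_. 0) c"
    proof (rule pairing_cong)
      fix \<sigma> assume "\<sigma> \<in> Poly_Mapping.keys c"
      then obtain x y where "\<sigma> = {x, y}" "x \<noteq> y" by (rule chains_1_keyE[OF c(1)])
      then show "coboundary e \<sigma> = 0" by (simp add: coboundary_edge e_def)
    qed
    finally have "pairing e (boundary c) = 0" by simp
    moreover have "pairing e (T c) = 1" unfolding c(2)[symmetric] by (simp add: e_def)
    ultimately have "pairing f c = 1" by (simp add: T_def pairing_add e_def)
    then have "boundary c = 0" using c(2) unfolding T_def by simp
    then show False using f_cycle[of c] c(1) \<open>pairing f c = 1\<close> by (simp add: cycles_def)
  qed
  ultimately obtain g where g: "\<And>c. c \<in> W \<Longrightarrow> pairing g c = 0"
    "pairing g (Poly_Mapping.single {} 1) = 1"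
    using separating_functional by blast
  have key: "\<phi> x y = g {x} + g {y}" if xy: "x \<in> Y" "y \<in> Y" "dist x y \<le> s" for x y
  proof (cases "x = y")
    case True
    then show ?thesis using edge_cocycle_refl[OF \<phi>(1), of x] xy assms(2) by simp
  next
    case False
    have "T (Poly_Mapping.single {x, y} 1) \<in> W"
      unfolding W_def using single_edge_chain[OF False xy] by blast
    then have "0 = pairing g (T (Poly_Mapping.single {x, y} 1))" by (rule g(1)[symmetric])
    also have "\<dots> = pairing (coboundary g) (Poly_Mapping.single {x, y} 1)
      + pairing g (Poly_Mapping.single {} (f {x, y} * 1))"
      unfolding T_def pairing_add pairing_boundary pairing_single ..
    also have "pairing (coboundary g) (Poly_Mapping.single {x, y} 1) = g {x} + g {y}"
      unfolding pairing_single coboundary_edge[OF False] by (rule mult_1_right)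
    also have "pairing g (Poly_Mapping.single {} (f {x, y} * 1)) = f {x, y}"
      using g(2) unfolding pairing_single by (simp only: mult_1_left mult_1_right)
    also have "f {x, y} = \<phi> x y"
      by (rule f) (use xy assms(2) in auto)
    finally show ?thesis by (rule bit_add_zeroD)
  qed
  have "edge_coboundary Y s \<phi>" unfolding edge_coboundary_def
    by (intro exI[of _ "\<lambda>x. g {x}"] ballI impI key)
  with \<phi>(2) show False by simp
qed

lemma survives_iff:
  assumes "s \<le> t"
  shows "survives Y s t \<longleftrightarrow>
    \<not> cycles 1 (vietoris_rips Y s) \<subseteq> boundaries 1 (vietoris_rips Y t)"
  using survives_if_not_cycles_subset_boundaries not_cycles_subset_boundaries_if_survives assms
  by blast

lemma bit_telescope:
  fixes a :: bit
  assumes "u = a + q" "u = p + v" "v = c + d"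
  shows "a = (c + p) + (d + q)"
  using assms by (cases a; cases q; cases p; cases c; cases d) simp_all

text \<open>Pulling back along \<open>\<psi>\<close> preserves cocycles. A potential \<open>\<alpha>\<close> for the pull-back yields one
  for \<open>\<phi>\<close> itself, namely \<open>\<alpha> \<circ> f\<close> corrected by the values of \<open>\<phi>\<close> on the short edges from \<open>x\<close> to
  \<open>\<psi> (f x)\<close>. This replaces the usual chain homotopy between contiguous simplicial maps.\<close>
lemma survives_transfer:
  assumes "survives Y s t" "s \<le> t"
    and \<psi>: "\<And>x. x \<in> Y' \<Longrightarrow> \<psi> x \<in> Y"
      "\<And>x y. x \<in> Y' \<Longrightarrow> y \<in> Y' \<Longrightarrow> dist x y \<le> t' \<Longrightarrow> dist (\<psi> x) (\<psi> y) \<le> t"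
    and f: "\<And>x. x \<in> Y \<Longrightarrow> f x \<in> Y'"
      "\<And>x y. x \<in> Y \<Longrightarrow> y \<in> Y \<Longrightarrow> dist x y \<le> s \<Longrightarrow> dist (f x) (f y) \<le> s'"
    and \<psi>f: "\<And>x y. x \<in> Y \<Longrightarrow> y \<in> Y \<Longrightarrow> dist x y \<le> s \<Longrightarrow>
        dist x (\<psi> (f y)) \<le> t \<and> dist (\<psi> (f x)) (\<psi> (f y)) \<le> t"
  shows "survives Y' s' t'"
proof -
  obtain \<phi> where \<phi>: "edge_cocycle Y t \<phi>" "\<not> edge_coboundary Y s \<phi>"
    using assms(1) unfolding survives_def by blast
  have "edge_cocycle Y' t' (\<lambda>x y. \<phi> (\<psi> x) (\<psi> y))"
    unfolding edge_cocycle_def by (intro ballI impI edge_cocycleD[OF \<phi>(1)]) (auto simp: \<psi>)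
  moreover have "\<not> edge_coboundary Y' s' (\<lambda>x y. \<phi> (\<psi> x) (\<psi> y))"
  proof
    assume "edge_coboundary Y' s' (\<lambda>x y. \<phi> (\<psi> x) (\<psi> y))"
    then obtain \<alpha> where \<alpha>: "\<And>x y. x \<in> Y' \<Longrightarrow> y \<in> Y' \<Longrightarrow> dist x y \<le> s' \<Longrightarrow>
      \<phi> (\<psi> x) (\<psi> y) = \<alpha> x + \<alpha> y" unfolding edge_coboundary_def by blast
    have key: "\<phi> x y = (\<alpha> (f x) + \<phi> x (\<psi> (f x))) + (\<alpha> (f y) + \<phi> y (\<psi> (f y)))"
      if xy: "x \<in> Y" "y \<in> Y" "dist x y \<le> s" for x y
    proof -
      have "0 \<le> s" using xy(3) zero_le_dist[of x y] by linarith
      have fY: "\<psi> (f x) \<in> Y" "\<psi> (f y) \<in> Y" using xy f \<psi> by auto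
      have d: "dist x (\<psi> (f y)) \<le> t" "dist (\<psi> (f x)) (\<psi> (f y)) \<le> t" "dist x y \<le> t"
        "dist x (\<psi> (f x)) \<le> t" "dist y (\<psi> (f y)) \<le> t"
        using \<psi>f[of x y] \<psi>f[of x x] \<psi>f[of y y] xy \<open>0 \<le> s\<close> assms(2) by auto
      have "\<phi> x (\<psi> (f y)) = \<phi> x y + \<phi> y (\<psi> (f y))"
        by (rule edge_cocycleD[OF \<phi>(1)]) (use xy fY d in auto)
      moreover have "\<phi> x (\<psi> (f y)) = \<phi> x (\<psi> (f x)) + \<phi> (\<psi> (f x)) (\<psi> (f y))"
        by (rule edge_cocycleD[OF \<phi>(1)]) (use xy fY d in auto)
      moreover have "\<phi> (\<psi> (f x)) (\<psi> (f y)) = \<alpha> (f x) + \<alpha> (f y)"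
        using \<alpha> f xy by auto
      ultimately show ?thesis
        by (rule bit_telescope)
    qed
    have "edge_coboundary Y s \<phi>" unfolding edge_coboundary_def
      by (intro exI[of _ "\<lambda>x. \<alpha> (f x) + \<phi> x (\<psi> (f x))"] ballI impI key)
    with \<phi>(2) show False by simp
  qed
  ultimately show ?thesis unfolding survives_def by blast
qed

text \<open>Only the edges present at the two scales matter, which is why the hypotheses compare
  distances within \<open>Y\<close> rather than the scales.\<close>
lemma survives_mono:
  assumes "survives Y s t"
    and "\<And>x y. x \<in> Y \<Longrightarrow> y \<in> Y \<Longrightarrow> dist x y \<le> s \<Longrightarrow> dist x y \<le> s'"
    and "\<And>x y. x \<in> Y \<Longrightarrow> y \<in> Y \<Longrightarrow> dist x y \<le> t' \<Longrightarrow> dist x y \<le> t"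
  shows "survives Y s' t'"
proof -
  obtain \<phi> where \<phi>: "edge_cocycle Y t \<phi>" "\<not> edge_coboundary Y s \<phi>"
    using assms(1) unfolding survives_def by blast
  have "edge_cocycle Y t' \<phi>"
    unfolding edge_cocycle_def by (intro ballI impI edge_cocycleD[OF \<phi>(1)]) (auto simp: assms(3))
  moreover have "\<not> edge_coboundary Y s' \<phi>"
    using \<phi>(2) assms(2) unfolding edge_coboundary_def by metis
  ultimately show ?thesis unfolding survives_def by blast
qed

lemma not_survives_negative:
  assumes "s < 0"
  shows "\<not> survives Y s t"
proof -
  have "\<not> dist x y \<le> s" for x y :: 'a using assms zero_le_dist[of x y] by linarith
  then show ?thesis by (simp add: survives_def edge_coboundary_def)
qed

text \<open>On a full simplex a cocycle is the coboundary of its values on the edges to a fixed vertex.\<close>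
lemma not_survives_diameter:
  assumes "\<And>x y. x \<in> Y \<Longrightarrow> y \<in> Y \<Longrightarrow> dist x y \<le> t"
  shows "\<not> survives Y s t"
proof
  assume "survives Y s t"
  then obtain \<phi> where \<phi>: "edge_cocycle Y t \<phi>" "\<not> edge_coboundary Y s \<phi>"
    unfolding survives_def by blast
  show False
  proof (cases "Y = {}")
    case True
    then show False using \<phi>(2) by (simp add: edge_coboundary_def)
  next
    case False
    then obtain p where p: "p \<in> Y" by blast
    have key: "\<phi> x y = \<phi> x p + \<phi> y p" if xy: "x \<in> Y" "y \<in> Y" for x y
    proof -
      have "\<phi> x y = \<phi> x p + \<phi> p y" by (rule edge_cocycleD[OF \<phi>(1)]) (use xy p assms in auto)
      also have "\<phi> p y = \<phi> y p" by (rule edge_cocycle_sym[OF \<phi>(1)]) (use xy p assms in auto)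
      finally show ?thesis .
    qed
    have "edge_coboundary Y s \<phi>" unfolding edge_coboundary_def
      by (intro exI[of _ "\<lambda>x. \<phi> x p"] ballI impI key)
    with \<phi>(2) show False by simp
  qed
qed

text \<open>Maps that pick a point within \<open>q\<close> change distances by at most \<open>2q\<close>; their composition moves
  points by at most \<open>2q\<close>, and its image stays within scale \<open>s + 4q\<close>.\<close>
lemma survives_perturb:
  assumes "survives Y s t" "s + 4 * q \<le> t" "0 \<le> q"
    and Y: "\<And>y. y \<in> Y \<Longrightarrow> \<exists>x\<in>X. dist y x \<le> q"
    and X: "\<And>x. x \<in> X \<Longrightarrow> \<exists>y\<in>Y. dist x y \<le> q"
  shows "survives X (s + 2 * q) (t - 2 * q)"
proof -
  obtain f where f: "\<And>y. y \<in> Y \<Longrightarrow> f y \<in> X \<and> dist y (f y) \<le> q" using Y by metis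
  obtain \<psi> where \<psi>: "\<And>x. x \<in> X \<Longrightarrow> \<psi> x \<in> Y \<and> dist x (\<psi> x) \<le> q" using X by metis
  show ?thesis
  proof (rule survives_transfer[OF assms(1), where f = f and \<psi> = \<psi>])
    show "s \<le> t" using assms by linarith
  next
    fix x y assume xy: "x \<in> X" "y \<in> X" "dist x y \<le> t - 2 * q"
    have "dist (\<psi> x) (\<psi> y) \<le> dist x (\<psi> x) + dist x y + dist y (\<psi> y)" by metric
    then show "dist (\<psi> x) (\<psi> y) \<le> t" using \<psi>[of x] \<psi>[of y] xy by linarith
  next
    fix x y assume xy: "x \<in> Y" "y \<in> Y" "dist x y \<le> s"
    have "dist (f x) (f y) \<le> dist x (f x) + dist x y + dist y (f y)" by metric
    then show f2: "dist (f x) (f y) \<le> s + 2 * q" using f[of x] f[of y] xy by linarith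
    have "dist x (\<psi> (f y)) \<le> dist x y + dist y (f y) + dist (f y) (\<psi> (f y))" by metric
    moreover have "dist (\<psi> (f x)) (\<psi> (f y)) \<le>
      dist (f x) (\<psi> (f x)) + dist (f x) (f y) + dist (f y) (\<psi> (f y))" by metric
    ultimately show "dist x (\<psi> (f y)) \<le> t \<and> dist (\<psi> (f x)) (\<psi> (f y)) \<le> t"
      using f[of x] f[of y] \<psi>[of "f x"] \<psi>[of "f y"] xy f2 assms(2,3) by linarith
  qed (use f \<psi> in auto)
qed

section \<open>Dimensions of chain spaces\<close>

lemma chain_add_cancel: "(c + d) + d = c" for c d :: "'a chain"
  by (simp add: add.assoc)

lemma finite_chains:
  assumes "finite Y"
  shows "finite (chains p (vietoris_rips Y t))"
proof -
  have "inj_on Poly_Mapping.keys (chains p (vietoris_rips Y t))"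
  proof (rule inj_onI)
    fix c d :: "'a chain" assume "Poly_Mapping.keys c = Poly_Mapping.keys d"
    then show "c = d" using chain_eq_sum_singles[of c] chain_eq_sum_singles[of d] by metis
  qed
  moreover have "Poly_Mapping.keys ` chains p (vietoris_rips Y t) \<subseteq> Pow (Pow Y)"
    by (auto simp: chains_def vietoris_rips_def)
  then have "finite (Poly_Mapping.keys ` chains p (vietoris_rips Y t))"
    using assms by (meson finite_Pow_iff finite_subset)
  ultimately show ?thesis by (rule finite_imageD[rotated])
qed

text \<open>Over the field with two elements the vectors of a space correspond to the subsets of a
  basis. Dimension inequalities for finite spaces thus become counting statements.\<close>
lemma card_f2_subspace:
  fixes V :: "'a chain set"
  assumes "f2.subspace V" "finite V"
  shows "card V = 2 ^ f2_dim V"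
proof -
  obtain B where B: "B \<subseteq> V" "f2.independent B" "V \<subseteq> f2.span B" "card B = f2_dim V"
    by (rule f2.basis_exists)
  have fB: "finite B" using B(1) assms(2) finite_subset by blast
  have V: "V = f2.span B" using B(3) f2.span_minimal[OF B(1) assms(1)] by simp
  have sub: "S \<subseteq> S'" if S: "S \<subseteq> B" "S' \<subseteq> B" "\<Sum>S = \<Sum>S'" for S S'
  proof
    fix b assume b: "b \<in> S"
    show "b \<in> S'"
    proof (rule ccontr)
      assume nb: "b \<notin> S'"
      have "finite S" using S(1) fB by (rule finite_subset)
      then have eq: "\<Sum>S' = b + \<Sum>(S - {b})"
        unfolding S(3)[symmetric] by (rule sum.remove[OF _ b])
      have "b = \<Sum>S' + \<Sum>(S - {b})"
        unfolding eq chain_add_cancel ..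
      moreover have "\<Sum>S' + \<Sum>(S - {b}) \<in> f2.span (B - {b})"
      proof (intro f2.span_add f2.span_sum f2.span_base)
        show "x \<in> B - {b}" if "x \<in> S'" for x using that nb S(2) by blast
        show "x \<in> B - {b}" if "x \<in> S - {b}" for x using that S(1) by blast
      qed
      ultimately have "b \<in> f2.span (B - {b})" by (rule ssubst)
      moreover have "b \<in> B" using b S(1) by (rule subsetD[rotated])
      ultimately show False using B(2) unfolding f2.dependent_def by (elim notE) (rule bexI)
    qed
  qed
  have inj: "inj_on (\<lambda>S. \<Sum>S) (Pow B)"
  proof (rule inj_onI)
    fix S S' assume "S \<in> Pow B" "S' \<in> Pow B" "\<Sum>S = \<Sum>S'"
    then show "S = S'" using sub[of S S'] sub[of S' S] by simp
  qed
  have "(\<lambda>S. \<Sum>S) ` Pow B = V"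
  proof
    show "(\<lambda>S. \<Sum>S) ` Pow B \<subseteq> V"
      unfolding V by (auto intro: f2.span_sum f2.span_base)
    show "V \<subseteq> (\<lambda>S. \<Sum>S) ` Pow B"
    proof
      fix v assume "v \<in> V"
      then obtain u where "v = (\<Sum>b\<in>B. Poly_Mapping.map ((*) (u b)) b)"
        unfolding V f2.span_finite[OF fB] by (rule rangeE)
      also have "\<dots> = (\<Sum>b\<in>B. if u b \<noteq> 0 then b else 0)"
        unfolding bit_scale_cases by (intro sum.cong) auto
      also have "\<dots> = \<Sum>{b\<in>B. u b \<noteq> 0}"
        by (rule sum.inter_filter[symmetric, OF fB])
      finally show "v \<in> (\<lambda>S. \<Sum>S) ` Pow B" by blast
    qed
  qed
  then have "card V = card (Pow B)" using card_image[OF inj] by simp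
  then show ?thesis using fB B(4) by (simp add: card_Pow)
qed

lemma f2_dim_mono:
  assumes "f2.subspace U" "f2.subspace V" "finite V" "U \<subseteq> V"
  shows "f2_dim U \<le> f2_dim V"
proof -
  have "card U \<le> card V" "finite U" using assms by (auto intro: card_mono finite_subset)
  then have "(2::nat) ^ f2_dim U \<le> 2 ^ f2_dim V" using assms by (simp add: card_f2_subspace)
  then show ?thesis by simp
qed

lemma f2_dim_eq_imp_eq:
  assumes "f2.subspace U" "f2.subspace V" "finite V" "U \<subseteq> V" "f2_dim U = f2_dim V"
  shows "U = V"
proof -
  have "finite U" using assms by (auto intro: finite_subset)
  then have "card U = card V" using assms by (simp add: card_f2_subspace)
  then show ?thesis using assms by (intro card_subset_eq) auto
qed

text \<open>One half of the dimension formula for \<open>S + T\<close>. The pair \<open>(s, t)\<close> is determined by \<open>s + t\<close> together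
  with the difference between \<open>s\<close> and a fixed first component for the same sum, and that difference
  lies in \<open>S \<inter> T\<close>.\<close>
lemma f2_dim_sum_le:
  assumes S: "f2.subspace S" "S \<subseteq> V" and T: "f2.subspace T" "T \<subseteq> V"
    and V: "f2.subspace V" "finite V"
  shows "f2_dim S + f2_dim T \<le> f2_dim V + f2_dim (S \<inter> T)"
proof -
  have fin: "finite S" "finite T" "finite (S \<inter> T)" using finite_subset[OF S(2) V(2)] finite_subset[OF T(2) V(2)] by auto
  have sub: "f2.subspace (S \<inter> T)" using f2.subspace_inter[OF S(1) T(1)] .
  define \<sigma> where "\<sigma> v = (SOME s. s \<in> S \<and> v + s \<in> T)" for v
  define \<Phi> where "\<Phi> = (\<lambda>(s, t). (s + t, s + \<sigma> (s + t)))"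
  have \<sigma>: "\<sigma> (s + t) \<in> S \<and> (s + t) + \<sigma> (s + t) \<in> T" if "s \<in> S" "t \<in> T" for s t
    unfolding \<sigma>_def
  proof (rule someI[of _ s])
    have "(s + t) + s = t" using chain_add_cancel[of t s] by (simp only: add.commute)
    with that show "s \<in> S \<and> (s + t) + s \<in> T" by (simp only: simp_thms)
  qed
  have "\<Phi> ` (S \<times> T) \<subseteq> V \<times> (S \<inter> T)"
  proof (clarsimp simp: \<Phi>_def, intro conjI)
    fix s t assume st: "s \<in> S" "t \<in> T"
    show "s + t \<in> V" using st S(2) T(2) f2.subspace_add[OF V(1)] by blast
    show "s + \<sigma> (s + t) \<in> S" using st \<sigma> f2.subspace_add[OF S(1)] by blast
    have "((s + t) + \<sigma> (s + t)) + t = s + \<sigma> (s + t)"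
      using chain_add_cancel[of "s + \<sigma> (s + t)" t] by (simp only: add_ac)
    moreover have "((s + t) + \<sigma> (s + t)) + t \<in> T"
      using st \<sigma> by (blast intro: f2.subspace_add[OF T(1)])
    ultimately show "s + \<sigma> (s + t) \<in> T" by (rule subst)
  qed
  moreover have "inj_on \<Phi> (S \<times> T)"
  proof (rule inj_onI)
    fix p p' assume "\<Phi> p = \<Phi> p'"
    then have "fst p + snd p = fst p' + snd p'"
      "fst p + \<sigma> (fst p + snd p) = fst p' + \<sigma> (fst p' + snd p')"
      by (auto simp: \<Phi>_def split: prod.splits)
    then show "p = p'" by (auto intro!: prod_eqI)
  qed
  ultimately have "card (S \<times> T) \<le> card (V \<times> (S \<inter> T))"
    using V(2) fin by (intro card_inj_on_le) auto
  then have "(2::nat) ^ (f2_dim S + f2_dim T) \<le> 2 ^ (f2_dim V + f2_dim (S \<inter> T))"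
    using S(1) T(1) V sub fin by (simp add: card_cartesian_product card_f2_subspace power_add)
  then show ?thesis by simp
qed

section \<open>Points of the persistence diagram\<close>

text \<open>The dimension of \<open>Z / (Z \<inter> B)\<close> for a finite space \<open>Z\<close>, as an integer so that alternating sums need
  no care.\<close>
definition quotient_dim :: "'a chain set \<Rightarrow> 'a chain set \<Rightarrow> int" where
  "quotient_dim Z B = int (f2_dim Z) - int (f2_dim (Z \<inter> B))"

context
  fixes Y :: "'a::metric_space set"
  assumes fin: "finite Y"
begin

lemma finite_cycles: "finite (cycles p (vietoris_rips Y t))"
  using finite_chains[OF fin] by (rule finite_subset[rotated]) (auto simp: cycles_def)

lemma persistent_betti_int:
  "int (persistent_betti p Y s t) =
     quotient_dim (cycles p (vietoris_rips Y s)) (boundaries p (vietoris_rips Y t))"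
proof -
  have "f2_dim (cycles p (vietoris_rips Y s) \<inter> boundaries p (vietoris_rips Y t))
      \<le> f2_dim (cycles p (vietoris_rips Y s))"
    by (intro f2_dim_mono f2.subspace_inter cycles_subspace boundaries_subspace finite_cycles) auto
  then show ?thesis unfolding persistent_betti_def quotient_dim_def by simp
qed

lemma persistent_betti_pos_iff:
  "persistent_betti p Y s t > 0 \<longleftrightarrow>
    \<not> cycles p (vietoris_rips Y s) \<subseteq> boundaries p (vietoris_rips Y t)"
proof -
  let ?Z = "cycles p (vietoris_rips Y s)" and ?B = "boundaries p (vietoris_rips Y t)"
  have sub: "f2.subspace (?Z \<inter> ?B)"
    by (intro f2.subspace_inter cycles_subspace boundaries_subspace)
  have "f2_dim (?Z \<inter> ?B) \<le> f2_dim ?Z"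
    by (intro f2_dim_mono sub cycles_subspace finite_cycles) auto
  moreover have "f2_dim (?Z \<inter> ?B) = f2_dim ?Z \<longleftrightarrow> ?Z \<inter> ?B = ?Z"
    using f2_dim_eq_imp_eq[OF sub cycles_subspace finite_cycles] by auto
  ultimately show ?thesis unfolding persistent_betti_def by (auto simp: Int_absorb2)
qed

lemma chains_rips_mono: "s \<le> t \<Longrightarrow> chains p (vietoris_rips Y s) \<subseteq> chains p (vietoris_rips Y t)"
  unfolding chains_def vietoris_rips_def by fastforce

lemma cycles_rips_mono: "s \<le> t \<Longrightarrow> cycles p (vietoris_rips Y s) \<subseteq> cycles p (vietoris_rips Y t)"
  using chains_rips_mono by (auto simp: cycles_def)

lemma boundaries_rips_mono:
  "s \<le> t \<Longrightarrow> boundaries p (vietoris_rips Y s) \<subseteq> boundaries p (vietoris_rips Y t)"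
  unfolding boundaries_def by (intro image_mono chains_rips_mono)

lemma persistent_betti_antimono:
  assumes "t \<le> t'"
  shows "persistent_betti p Y s t' \<le> persistent_betti p Y s t"
proof -
  have "f2_dim (cycles p (vietoris_rips Y s) \<inter> boundaries p (vietoris_rips Y t))
      \<le> f2_dim (cycles p (vietoris_rips Y s) \<inter> boundaries p (vietoris_rips Y t'))"
    using boundaries_rips_mono[OF assms]
    by (intro f2_dim_mono f2.subspace_inter cycles_subspace boundaries_subspace
        finite_Int disjI1 finite_cycles) auto
  then show ?thesis unfolding persistent_betti_def by simp
qed

text \<open>The alternating sum over a rectangle of scales counts classes, so it is nonnegative. Here
  this is the dimension inequality for the subspaces \<open>Z\<^sub>s \<inter> B\<^sub>t\<^sub>'\<close> and \<open>Z\<^sub>s\<^sub>' \<inter> B\<^sub>t\<close>.\<close>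
lemma persistent_betti_rectangle:
  assumes "s \<le> s'" "t \<le> t'"
  shows "int (persistent_betti p Y s t) - int (persistent_betti p Y s t') \<le>
    int (persistent_betti p Y s' t) - int (persistent_betti p Y s' t')"
proof -
  let ?Z = "cycles p (vietoris_rips Y s)" and ?B = "boundaries p (vietoris_rips Y t)"
  let ?Z' = "cycles p (vietoris_rips Y s')" and ?B' = "boundaries p (vietoris_rips Y t')"
  have Z: "?Z \<subseteq> ?Z'" and B: "?B \<subseteq> ?B'"
    using assms cycles_rips_mono boundaries_rips_mono by auto
  have "f2_dim (?Z \<inter> ?B') + f2_dim (?Z' \<inter> ?B) \<le>
      f2_dim (?Z' \<inter> ?B') + f2_dim ((?Z \<inter> ?B') \<inter> (?Z' \<inter> ?B))"
    using Z B by (intro f2_dim_sum_le f2.subspace_inter cycles_subspace boundaries_subspace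
        finite_Int disjI1 finite_cycles) auto
  also have "(?Z \<inter> ?B') \<inter> (?Z' \<inter> ?B) = ?Z \<inter> ?B" using Z B by auto
  finally show ?thesis by (simp add: persistent_betti_int quotient_dim_def)
qed

lemma eventually_dist_le:
  "\<forall>\<^sub>F e in at_right 0. \<forall>x\<in>Y. \<forall>y\<in>Y. dist x y \<le> b - e \<longleftrightarrow> dist x y < b"
proof -
  have "\<forall>\<^sub>F e in at_right 0. dist x y \<le> b - e \<longleftrightarrow> dist x y < b" for x y :: 'a
  proof (cases "dist x y < b")
    case True
    then have "\<forall>\<^sub>F e in at_right 0. e < b - dist x y"
      by (intro eventually_at_right_less[THEN eventually_mono] order_tendstoD) auto
    then show ?thesis by eventually_elim (use True in linarith)
  next
    case False
    have "\<forall>\<^sub>F e in at_right (0::real). 0 < e" by (rule eventually_at_right_less)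
    then show ?thesis by eventually_elim (use False in linarith)
  qed
  then show ?thesis by (intro eventually_ball_finite[OF fin] ballI)
qed

lemma vietoris_rips_cong:
  assumes "\<And>x y. x \<in> Y \<Longrightarrow> y \<in> Y \<Longrightarrow> dist x y \<le> s \<longleftrightarrow> dist x y \<le> t"
  shows "vietoris_rips Y s = vietoris_rips Y t"
proof -
  have "(\<forall>x\<in>\<sigma>. \<forall>y\<in>\<sigma>. dist x y \<le> s) = (\<forall>x\<in>\<sigma>. \<forall>y\<in>\<sigma>. dist x y \<le> t)" if "\<sigma> \<subseteq> Y" for \<sigma>
    using assms that by (intro ball_cong refl) auto
  then show ?thesis unfolding vietoris_rips_def by auto
qed

lemma eventually_vietoris_rips_eq:
  obtains K where "\<forall>\<^sub>F e in at_right 0. vietoris_rips Y (b - e) = K"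
proof -
  have "\<exists>e0. \<forall>x\<in>Y. \<forall>y\<in>Y. dist x y \<le> b - e0 \<longleftrightarrow> dist x y < b"
    using eventually_happens'[OF trivial_limit_at_right_real eventually_dist_le[of b]] .
  then obtain e0 where e0: "\<And>x y. x \<in> Y \<Longrightarrow> y \<in> Y \<Longrightarrow> dist x y \<le> b - e0 \<longleftrightarrow> dist x y < b" by blast
  have "\<forall>\<^sub>F e in at_right 0. vietoris_rips Y (b - e) = vietoris_rips Y (b - e0)"
    using eventually_dist_le[of b]
    by eventually_elim (intro vietoris_rips_cong, simp add: e0)
  then show ?thesis by (rule that)
qed

text \<open>The description of the multiplicity by \<open>THE\<close> is meaningful: just below \<open>b\<close> and \<open>d\<close> the complexes
  do not change, so the alternating sum is eventually constant, and it is nonnegative by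
  \<open>persistent_betti_rectangle\<close>.\<close>
lemma eventually_pd_multiplicity:
  assumes "b < d"
  shows "\<forall>\<^sub>F e in at_right 0. int (pd_multiplicity p Y b d) =
     (int (persistent_betti p Y b (d - e)) - int (persistent_betti p Y b d)) -
     (int (persistent_betti p Y (b - e) (d - e)) - int (persistent_betti p Y (b - e) d))"
    (is "\<forall>\<^sub>F e in _. int _ = ?N e")
proof -
  obtain Kb where Kb: "\<forall>\<^sub>F e in at_right 0. vietoris_rips Y (b - e) = Kb"
    by (rule eventually_vietoris_rips_eq)
  obtain Kd where Kd: "\<forall>\<^sub>F e in at_right 0. vietoris_rips Y (d - e) = Kd"
    by (rule eventually_vietoris_rips_eq)
  define N where "N = (quotient_dim (cycles p (vietoris_rips Y b)) (boundaries p Kd)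
     - quotient_dim (cycles p (vietoris_rips Y b)) (boundaries p (vietoris_rips Y d)))
     - (quotient_dim (cycles p Kb) (boundaries p Kd)
        - quotient_dim (cycles p Kb) (boundaries p (vietoris_rips Y d)))"
  have N: "\<forall>\<^sub>F e in at_right 0. ?N e = N"
    using Kb Kd by eventually_elim (simp add: persistent_betti_int N_def)
  have "\<forall>\<^sub>F e in at_right (0::real). 0 < e" by (rule eventually_at_right_less)
  then have "\<forall>\<^sub>F e in at_right 0. 0 \<le> ?N e"
  proof eventually_elim
    case (elim e)
    then show ?case using persistent_betti_rectangle[of "b - e" b "d - e" d p] by simp
  qed
  with N have "\<forall>\<^sub>F e in at_right (0::real). 0 \<le> N" by eventually_elim simp
  then have "0 \<le> N" by simp
  then have "pd_multiplicity p Y b d = nat N"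
    unfolding pd_multiplicity_def
  proof (intro the_equality)
    show "\<forall>\<^sub>F e in at_right 0. int (nat N) = ?N e"
      using N by eventually_elim (use \<open>0 \<le> N\<close> in simp)
    fix k assume "\<forall>\<^sub>F e in at_right 0. int k = ?N e"
    with N have "\<forall>\<^sub>F e in at_right (0::real). int k = N" by eventually_elim simp
    then show "k = nat N" by simp
  qed
  then have mult: "int (pd_multiplicity p Y b d) = N" using \<open>0 \<le> N\<close> by simp
  show ?thesis using N by eventually_elim (simp add: mult)
qed

lemma finite_critical_values: "finite (critical_values Y)"
proof -
  have "critical_values Y = (\<lambda>(x, y). dist x y) ` (Y \<times> Y)" by (auto simp: critical_values_def)
  then show ?thesis using fin by simp
qed

lemma mem_persistence_diagram_iff:
  "(b, d) \<in># persistence_diagram p Y \<longleftrightarrow>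
    b \<in> critical_values Y \<and> d \<in> critical_values Y \<and> b < d \<and> pd_multiplicity p Y b d > 0"
proof -
  let ?S = "{(b, d). b \<in> critical_values Y \<and> d \<in> critical_values Y \<and> b < d}"
  have "finite ?S"
    by (rule finite_subset[of _ "critical_values Y \<times> critical_values Y"])
      (auto simp: finite_critical_values)
  then show ?thesis
    unfolding persistence_diagram_def by (auto simp: set_mset_sum in_replicate_mset split: prod.splits)
qed

lemma survives_of_mem_diagram:
  assumes "(b, d) \<in># persistence_diagram 1 Y" "b \<le> t" "t < d"
  shows "survives Y b t"
proof -
  have bd: "b < d" "pd_multiplicity 1 Y b d > 0"
    using assms(1) by (auto simp: mem_persistence_diagram_iff)
  have "\<forall>\<^sub>F e in at_right 0. e < d - t \<and> 0 < e"
    using assms(3) eventually_at_right[of 0 "d - t"] by (auto simp: eventually_at_right_field intro!: exI[of _ "d - t"])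
  then have "\<forall>\<^sub>F e in at_right 0. survives Y b (d - e) \<and> e < d - t"
    using eventually_pd_multiplicity[OF bd(1), of 1]
  proof eventually_elim
    case (elim e)
    have "persistent_betti 1 Y (b - e) d \<le> persistent_betti 1 Y (b - e) (d - e)"
      using elim by (intro persistent_betti_antimono) auto
    then have "persistent_betti 1 Y b (d - e) > 0" using elim bd(2) by linarith
    then have "survives Y b (d - e)"
      unfolding persistent_betti_pos_iff
      using survives_if_not_cycles_subset_boundaries by blast
    with elim show ?case by simp
  qed
  then obtain e where "survives Y b (d - e)" "e < d - t"
    using eventually_happens'[OF trivial_limit_at_right_real] by blast
  then show ?thesis by (elim survives_mono) linarith+
qed

text \<open>Take the smallest critical \<open>b\<close> at which something survives up to \<open>t\<close>, and then the smallest
  critical \<open>d > t\<close> by which everything born up to \<open>b\<close> has died. Of the four ranks in the multiplicity of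
  \<open>(b, d)\<close> only the one at \<open>(b, d - e)\<close> is then nonzero.\<close>
lemma mem_diagram_of_survives:
  assumes "survives Y s t" "s \<le> t"
  obtains b d where "(b, d) \<in># persistence_diagram 1 Y" "b \<le> s" "t < d"
proof -
  let ?C = "critical_values Y"
  have birth: "\<exists>b\<in>?C. b \<le> s' \<and> survives Y b t'" if s': "survives Y s' t'" for s' t'
  proof -
    have "\<exists>x\<in>Y. \<exists>y\<in>Y. dist x y \<le> s'"
    proof (rule ccontr)
      assume "\<not> ?thesis"
      then have "survives Y (- 1) t'" by (intro survives_mono[OF s']) auto
      then show False using not_survives_negative[of "- 1" Y t'] by simp
    qed
    then have ne: "{c\<in>?C. c \<le> s'} \<noteq> {}" by (auto simp: critical_values_def)
    let ?b = "Max {c\<in>?C. c \<le> s'}"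
    have b: "?b \<in> {c\<in>?C. c \<le> s'}" using ne finite_critical_values by (intro Max_in) auto
    have "survives Y ?b t'"
    proof (rule survives_mono[OF s'])
      fix x y assume "x \<in> Y" "y \<in> Y" "dist x y \<le> s'"
      then show "dist x y \<le> ?b" using finite_critical_values
        by (intro Max_ge) (auto simp: critical_values_def)
    qed
    with b show ?thesis by auto
  qed
  \<comment> \<open>\<open>birth\<close>: a scale can be lowered to a critical value without losing edges, so minima over critical
    values are minima over all scales.\<close>
  let ?Bs = "{b\<in>?C. survives Y b t}"
  define b where "b = Min ?Bs"
  have fB: "finite ?Bs" using finite_critical_values by simp
  have "\<exists>b\<in>?Bs. b \<le> s" using birth[OF assms(1)] by auto
  then have bs: "b \<le> s" unfolding b_def using fB by (auto intro: Min_le order.trans)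
  have b: "b \<in> ?Bs" unfolding b_def using birth[OF assms(1)] fB by (intro Min_in) auto
  have b_min: "b \<le> s'" if "survives Y s' t" for s'
    using birth[OF that] fB unfolding b_def by (auto intro: Min_le order.trans)
  let ?Ds = "{d\<in>?C. t < d \<and> \<not> survives Y b d}"
  define d where "d = Min ?Ds"
  have fD: "finite ?Ds" using finite_critical_values by simp
  have "?Ds \<noteq> {}"
  proof -
    have C: "?C \<noteq> {}" using b by auto
    have max: "dist x y \<le> Max ?C" if "x \<in> Y" "y \<in> Y" for x y
      using that finite_critical_values by (intro Max_ge) (auto simp: critical_values_def)
    have "t < Max ?C"
    proof (rule ccontr)
      assume "\<not> t < Max ?C"
      then have "dist x y \<le> t" if "x \<in> Y" "y \<in> Y" for x y using max[OF that] by linarith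
      then show False using not_survives_diameter[of Y t b] b by blast
    qed
    moreover have "\<not> survives Y b (Max ?C)" using not_survives_diameter max by blast
    moreover have "Max ?C \<in> ?C" using C finite_critical_values by simp
    ultimately show ?thesis by blast
  qed
  then have d: "d \<in> ?Ds" unfolding d_def using fD by (intro Min_in)
  then have bd: "b < d" using bs assms(2) by auto
  have before_d: "survives Y b d'" if "d' < d" "t \<le> d'" for d'
  proof -
    let ?m = "Max (insert t {c\<in>?C. c \<le> d'})"
    have fm: "finite (insert t {c\<in>?C. c \<le> d'})" using finite_critical_values by simp
    have m: "?m \<in> insert t {c\<in>?C. c \<le> d'}" using fm by (intro Max_in) auto
    have "t \<le> ?m" using fm by (intro Max_ge) auto
    have "survives Y b ?m"
    proof (cases "?m = t")
      case True
      then show ?thesis using b by simp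
    next
      case False
      then have mC: "?m \<in> ?C" "t < ?m" "?m < d" using m \<open>t \<le> ?m\<close> that by auto
      show ?thesis
      proof (rule ccontr)
        assume "\<not> survives Y b ?m"
        then have "d \<le> ?m" unfolding d_def using mC fD by (intro Min_le) auto
        then show False using mC by simp
      qed
    qed
    then show ?thesis
    proof (rule survives_mono)
      fix x y assume "x \<in> Y" "y \<in> Y" "dist x y \<le> d'"
      then show "dist x y \<le> ?m" using fm by (intro Max_ge) (auto simp: critical_values_def)
    qed auto
  qed
  have "\<forall>\<^sub>F e in at_right 0. e < d - t \<and> 0 < e"
    using d eventually_at_right[of 0 "d - t"] by (auto simp: eventually_at_right_field intro!: exI[of _ "d - t"])
  then have "\<forall>\<^sub>F e in at_right (0::real). 0 < pd_multiplicity 1 Y b d"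
    using eventually_pd_multiplicity[OF bd, of 1]
  proof eventually_elim
    case (elim e)
    have "b \<le> d - e" using bs assms(2) elim by linarith
    then have "persistent_betti 1 Y b (d - e) > 0"
      using before_d[of "d - e"] elim by (simp add: persistent_betti_pos_iff survives_iff)
    moreover have "persistent_betti 1 Y b d = 0"
      using d bd persistent_betti_pos_iff[of 1 b d] by (simp add: survives_iff)
    moreover have "persistent_betti 1 Y (b - e) t' = 0" if t': "t \<le> t'" for t'
    proof -
      have "\<not> survives Y (b - e) t'"
      proof
        assume "survives Y (b - e) t'"
        then have "survives Y (b - e) t" by (rule survives_mono) (use t' in auto)
        from b_min[OF this] elim show False by simp
      qed
      moreover have "b - e \<le> t'" using bs assms(2) elim t' by linarith
      ultimately show ?thesis
        using persistent_betti_pos_iff[of 1 "b - e" t'] by (simp add: survives_iff)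
    qed
    then have "persistent_betti 1 Y (b - e) (d - e) = 0" "persistent_betti 1 Y (b - e) d = 0"
      using elim by auto
    ultimately show ?case using elim by linarith
  qed
  then have "0 < pd_multiplicity 1 Y b d" by simp
  with b d bd have "(b, d) \<in># persistence_diagram 1 Y" by (simp add: mem_persistence_diagram_iff)
  then show thesis using that bs d by auto
qed

end

section \<open>The dominant persistence of a random cloud\<close>

lemma dominant_persistence_nonneg:
  assumes "finite Y"
  shows "0 \<le> dominant_persistence Y"
proof (cases "persistence_diagram 1 Y = {#}")
  case False
  then obtain b d where bd: "(b, d) \<in># persistence_diagram 1 Y" by (metis multiset_nonemptyE prod.exhaust)
  then have "b < d" using mem_persistence_diagram_iff[OF assms] by blast
  then show ?thesis using False bd
    by (auto simp: dominant_persistence_def intro!: Max_ge_iff[THEN iffD2] bexI[of _ "(b, d)"])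
qed (simp add: dominant_persistence_def)

lemma less_dominant_persistence_iff:
  assumes "finite Y" "0 \<le> c"
  shows "c < dominant_persistence Y \<longleftrightarrow> (\<exists>(b, d)\<in>set_mset (persistence_diagram 1 Y). c < d - b)"
proof (cases "persistence_diagram 1 Y = {#}")
  case False
  then show ?thesis by (auto simp: dominant_persistence_def Max_gr_iff split: prod.splits)
qed (use assms in \<open>simp add: dominant_persistence_def\<close>)

lemma le_dominant_persistence_iff:
  assumes "finite Y" "0 < c"
  shows "c \<le> dominant_persistence Y \<longleftrightarrow> (\<exists>(b, d)\<in>set_mset (persistence_diagram 1 Y). c \<le> d - b)"
proof (cases "persistence_diagram 1 Y = {#}")
  case False
  then show ?thesis by (auto simp: dominant_persistence_def Max_ge_iff split: prod.splits)
qed (use assms in \<open>simp add: dominant_persistence_def\<close>)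

lemma less_dominant_persistence_of_survives:
  assumes "finite Y" "0 \<le> c" "survives Y s t" "s \<le> t" "c \<le> t - s"
  shows "c < dominant_persistence Y"
proof -
  obtain b d where "(b, d) \<in># persistence_diagram 1 Y" "b \<le> s" "t < d"
    using mem_diagram_of_survives[OF assms(1,3,4)] by blast
  then show ?thesis unfolding less_dominant_persistence_iff[OF assms(1,2)]
    using assms(5) by (intro bexI[of _ "(b, d)"]) auto
qed

text \<open>Rational scales suffice because the points of the diagram stand for half-open intervals; this
  makes the events below countable unions.\<close>
lemma survives_of_less_dominant_persistence:
  assumes "finite Y" "0 \<le> c" "c < dominant_persistence Y"
  obtains s t where "s \<in> \<rat>" "t \<in> \<rat>" "s \<le> t" "c \<le> t - s" "survives Y s t"
proof -
  obtain b d where bd: "(b, d) \<in># persistence_diagram 1 Y" "c < d - b"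
    using assms(3) unfolding less_dominant_persistence_iff[OF assms(1,2)] by auto
  define e where "e = (d - b - c) / 2"
  have e: "0 < e" using bd by (simp add: e_def)
  obtain s where s: "s \<in> \<rat>" "b < s" "s < b + e" using Rats_dense_in_real[of b "b + e"] e by auto
  obtain t where t: "t \<in> \<rat>" "d - e < t" "t < d" using Rats_dense_in_real[of "d - e" d] e by auto
  have ts: "c \<le> t - s" using s t by (simp add: e_def field_simps)
  have "survives Y b t" using survives_of_mem_diagram[OF assms(1) bd(1), of t] s t ts assms(2) by simp
  then have "survives Y s t" by (rule survives_mono) (use s in auto)
  then show ?thesis using that s t ts assms(2) by simp
qed

text \<open>Families of points are compared through their indices. The family may have repetitions, so the
  correspondence between the two clouds is only defined after a choice of indices; the transfer lemma
  tolerates this.\<close>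
lemma survives_image_cong:
  fixes p p' :: "'i \<Rightarrow> 'b::metric_space"
  assumes "survives (p ` I) s t" "s \<le> t"
    and s: "\<And>i j. i \<in> I \<Longrightarrow> j \<in> I \<Longrightarrow> dist (p i) (p j) \<le> s \<longleftrightarrow> dist (p' i) (p' j) \<le> s"
    and t: "\<And>i j. i \<in> I \<Longrightarrow> j \<in> I \<Longrightarrow> dist (p i) (p j) \<le> t \<longleftrightarrow> dist (p' i) (p' j) \<le> t"
  shows "survives (p' ` I) s t"
proof -
  define f where "f = (\<lambda>y. p' (SOME i. i \<in> I \<and> p i = y))"
  define \<psi> where "\<psi> = (\<lambda>y. p (SOME i. i \<in> I \<and> p' i = y))"
  have pick: "(SOME i. i \<in> I \<and> r i = y) \<in> I \<and> r (SOME i. i \<in> I \<and> r i = y) = y"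
    if "y \<in> r ` I" for y :: 'b and r
    using that by (intro someI_ex[of "\<lambda>i. i \<in> I \<and> r i = y"]) auto
  have f: "\<exists>i\<in>I. y = p i \<and> f y = p' i" if "y \<in> p ` I" for y
    unfolding f_def using pick[OF that] by (intro bexI[of _ "SOME i. i \<in> I \<and> p i = y"]) auto
  have \<psi>: "\<exists>i\<in>I. y = p' i \<and> \<psi> y = p i" if "y \<in> p' ` I" for y
    unfolding \<psi>_def using pick[OF that] by (intro bexI[of _ "SOME i. i \<in> I \<and> p' i = y"]) auto
  show ?thesis
  proof (rule survives_transfer[OF assms(1,2), where f = f and \<psi> = \<psi>])
    show "\<psi> y \<in> p ` I" if "y \<in> p' ` I" for y using \<psi>[OF that] by auto
    show "f y \<in> p' ` I" if "y \<in> p ` I" for y using f[OF that] by auto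
    show "dist (\<psi> x) (\<psi> y) \<le> t" if xy: "x \<in> p' ` I" "y \<in> p' ` I" "dist x y \<le> t" for x y
    proof -
      obtain i where i: "i \<in> I" "x = p' i" "\<psi> x = p i" using \<psi>[OF xy(1)] by auto
      obtain j where j: "j \<in> I" "y = p' j" "\<psi> y = p j" using \<psi>[OF xy(2)] by auto
      show ?thesis using xy(3) t[of i j] i j by simp
    qed
    fix x y assume xy: "x \<in> p ` I" "y \<in> p ` I" "dist x y \<le> s"
    obtain i where i: "i \<in> I" "x = p i" "f x = p' i" using f[OF xy(1)] by auto
    obtain j where j: "j \<in> I" "y = p j" "f y = p' j" using f[OF xy(2)] by auto
    show fxy: "dist (f x) (f y) \<le> s" using xy(3) s[of i j] i j by simp
    obtain i' where i': "i' \<in> I" "f x = p' i'" "\<psi> (f x) = p i'" using \<psi>[of "f x"] i by auto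
    obtain j' where j': "j' \<in> I" "f y = p' j'" "\<psi> (f y) = p j'" using \<psi>[of "f y"] j by auto
    have "dist (p' i) (p' j') \<le> s" "dist (p' i') (p' j') \<le> s" using fxy i j i' j' by auto
    then show "dist x (\<psi> (f y)) \<le> t \<and> dist (\<psi> (f x)) (\<psi> (f y)) \<le> t"
      using s[of i j'] s[of i' j'] i i' j' assms(2) by auto
  qed
qed

lemma measurable_dist_le_pattern:
  fixes p :: "'i \<Rightarrow> 'w \<Rightarrow> 'a::{metric_space, second_countable_topology}"
  assumes "finite I" "\<And>i. i \<in> I \<Longrightarrow> p i \<in> borel_measurable \<Omega>"
  shows "{w \<in> space \<Omega>. {ij \<in> I \<times> I. dist (p (fst ij) w) (p (snd ij) w) \<le> r} = A} \<in> sets \<Omega>"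
proof -
  have [measurable]: "\<And>i. i \<in> I \<Longrightarrow> p i \<in> borel_measurable \<Omega>" by fact
  have "Measurable.pred \<Omega> (\<lambda>w. dist (p (fst ij) w) (p (snd ij) w) \<le> r)" if "ij \<in> I \<times> I" for ij
    using that by (cases ij) simp
  then have "{w \<in> space \<Omega>. \<forall>ij \<in> I \<times> I. dist (p (fst ij) w) (p (snd ij) w) \<le> r \<longleftrightarrow> ij \<in> A} \<in> sets \<Omega>"
    using assms(1) by (intro sets.sets_Collect_finite_All) (auto simp: pred_def[symmetric])
  moreover have "{ij \<in> I \<times> I. dist (p (fst ij) w) (p (snd ij) w) \<le> r} = A \<longleftrightarrow>
     A \<subseteq> I \<times> I \<and> (\<forall>ij \<in> I \<times> I. dist (p (fst ij) w) (p (snd ij) w) \<le> r \<longleftrightarrow> ij \<in> A)" for w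
    by blast
  ultimately show ?thesis by (cases "A \<subseteq> I \<times> I") auto
qed

text \<open>By \<open>survives_image_cong\<close> the event is a union over the finitely many patterns of pairs at
  distance at most \<open>s\<close> and at most \<open>t\<close>.\<close>
lemma measurable_survives:
  fixes p :: "'i \<Rightarrow> 'w \<Rightarrow> 'a::{metric_space, second_countable_topology}"
  assumes I: "finite I" and p: "\<And>i. i \<in> I \<Longrightarrow> p i \<in> borel_measurable \<Omega>" and "s \<le> t"
  shows "{w \<in> space \<Omega>. survives ((\<lambda>i. p i w) ` I) s t} \<in> sets \<Omega>"
proof -
  define D where "D r w = {ij \<in> I \<times> I. dist (p (fst ij) w) (p (snd ij) w) \<le> r}" for r w
  define G where "G = {(A, B). \<exists>w\<in>space \<Omega>. D s w = A \<and> D t w = B \<and> survives ((\<lambda>i. p i w) ` I) s t}"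
  have "G \<subseteq> Pow (I \<times> I) \<times> Pow (I \<times> I)" by (auto simp: G_def D_def)
  then have "finite G" using I by (meson finite_Pow_iff finite_SigmaI finite_subset)
  have D: "dist (p i w) (p j w) \<le> r \<longleftrightarrow> dist (p i w') (p j w') \<le> r"
    if "D r w = D r w'" "i \<in> I" "j \<in> I" for r i j w w'
  proof -
    have "(i, j) \<in> D r w \<longleftrightarrow> (i, j) \<in> D r w'" using that(1) by simp
    then show ?thesis using that(2,3) by (simp add: D_def)
  qed
  have "survives ((\<lambda>i. p i w) ` I) s t" if "D s w = D s w'" "D t w = D t w'"
    "survives ((\<lambda>i. p i w') ` I) s t" for w w'
    by (rule survives_image_cong[OF that(3) assms(3)])
      (simp_all add: D[OF that(1)] D[OF that(2)])
  then have "{w \<in> space \<Omega>. survives ((\<lambda>i. p i w) ` I) s t} =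
    (\<Union>(A, B)\<in>G. {w \<in> space \<Omega>. D s w = A} \<inter> {w \<in> space \<Omega>. D t w = B})"
    by (auto simp: G_def)
  also have "\<dots> \<in> sets \<Omega>"
    using \<open>finite G\<close> measurable_dist_le_pattern[OF I p] unfolding D_def
    by (intro sets.finite_UN) (auto intro!: sets.Int)
  finally show ?thesis .
qed

lemma borel_measurable_dominant_persistence:
  fixes p :: "'i \<Rightarrow> 'w \<Rightarrow> 'a::{metric_space, second_countable_topology}"
  assumes I: "finite I" and p: "\<And>i. i \<in> I \<Longrightarrow> p i \<in> borel_measurable \<Omega>"
  shows "(\<lambda>w. dominant_persistence ((\<lambda>i. p i w) ` I)) \<in> borel_measurable \<Omega>"
  unfolding borel_measurable_iff_greater
proof
  fix c :: real
  let ?Y = "\<lambda>w. (\<lambda>i. p i w) ` I"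
  have fin: "finite (?Y w)" for w using I by simp
  show "{w \<in> space \<Omega>. c < dominant_persistence (?Y w)} \<in> sets \<Omega>"
  proof (cases "0 \<le> c")
    case False
    then have "c < dominant_persistence (?Y w)" for w
      using dominant_persistence_nonneg[OF fin, of w] by linarith
    then have "{w \<in> space \<Omega>. c < dominant_persistence (?Y w)} = space \<Omega>" by simp
    then show ?thesis by simp
  next
    case True
    let ?S = "{st \<in> \<rat> \<times> \<rat>. fst st \<le> snd st \<and> c \<le> snd st - fst st}"
    have "{w \<in> space \<Omega>. c < dominant_persistence (?Y w)} =
      (\<Union>st\<in>?S. {w \<in> space \<Omega>. survives (?Y w) (fst st) (snd st)})"
    proof (intro set_eqI iffI)
      fix w assume "w \<in> {w \<in> space \<Omega>. c < dominant_persistence (?Y w)}"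
      then have w: "w \<in> space \<Omega>" "c < dominant_persistence (?Y w)" by auto
      obtain s t where "s \<in> \<rat>" "t \<in> \<rat>" "s \<le> t" "c \<le> t - s" "survives (?Y w) s t"
        using survives_of_less_dominant_persistence[OF fin True w(2)] .
      with w(1) show "w \<in> (\<Union>st\<in>?S. {w \<in> space \<Omega>. survives (?Y w) (fst st) (snd st)})"
        by (intro UN_I[of "(s, t)"]) auto
    next
      fix w assume "w \<in> (\<Union>st\<in>?S. {w \<in> space \<Omega>. survives (?Y w) (fst st) (snd st)})"
      then show "w \<in> {w \<in> space \<Omega>. c < dominant_persistence (?Y w)}"
        using less_dominant_persistence_of_survives[OF fin True] by auto
    qed
    also have "\<dots> \<in> sets \<Omega>"
    proof (rule sets.countable_UN'')
      show "countable ?S" by (rule countable_subset[of _ "\<rat> \<times> \<rat>"]) (auto simp: countable_rat)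
      show "{w \<in> space \<Omega>. survives (?Y w) (fst st) (snd st)} \<in> sets \<Omega>" if "st \<in> ?S" for st
        using that by (intro measurable_survives I p) auto
    qed
    finally show ?thesis .
  qed
qed

section \<open>Samples of a closed curve of positive reach\<close>

text \<open>The graph of the projection is closed, and its values lie in a compact set.\<close>
lemma continuous_on_nearest_point:
  fixes M :: "'a::euclidean_space set"
  assumes M: "compact M"
    and uniq: "\<And>x. infdist x M < R \<Longrightarrow> \<exists>!y. y \<in> M \<and> dist x y = infdist x M"
  obtains \<pi> where "continuous_on {x. infdist x M < R} \<pi>"
    "\<And>x. infdist x M < R \<Longrightarrow> \<pi> x \<in> M"
    "\<And>x. x \<in> M \<Longrightarrow> infdist x M < R \<Longrightarrow> \<pi> x = x"
proof -
  define U where "U = {x. infdist x M < R}"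
  define \<pi> where "\<pi> x = (THE y. y \<in> M \<and> dist x y = infdist x M)" for x
  have \<pi>: "\<pi> x \<in> M \<and> dist x (\<pi> x) = infdist x M" if "x \<in> U" for x
    unfolding \<pi>_def using theI'[OF uniq[of x]] that by (simp add: U_def)
  have \<pi>_eq: "\<pi> x = y" if "x \<in> U" "y \<in> M" "dist x y = infdist x M" for x y
    using uniq[of x] \<pi>[of x] that unfolding U_def by blast
  have "(\<lambda>x. (x, \<pi> x)) ` U = {p \<in> U \<times> M. dist (fst p) (snd p) - infdist (fst p) M \<in> {0}}"
    using \<pi> \<pi>_eq by auto
  moreover have "closedin (top_of_set (U \<times> M))
      {p \<in> U \<times> M. dist (fst p) (snd p) - infdist (fst p) M \<in> {0}}"
    by (intro continuous_closedin_preimage_gen[where T = UNIV, unfolded vimage_def Int_def mem_Collect_eq]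
        continuous_closedin_preimage) (auto intro!: continuous_intros)
  ultimately have "continuous_on U \<pi>"
    using continuous_closed_graph_eq[OF M, of \<pi> U] \<pi> by auto
  then show ?thesis
    using that[of \<pi>] \<pi> \<pi>_eq unfolding U_def by auto
qed

text \<open>This is Jung's theorem in the plane, in the form needed for triangles. With barycentric
  coordinates \<open>a, b, c\<close> of \<open>p\<close>, the weighted mean of the squared distances to the vertices is
  \<open>a b |xy|\<^sup>2 + b c |yz|\<^sup>2 + a c |xz|\<^sup>2\<close>, and \<open>a b + b c + a c \<le> 1/3\<close>.\<close>
lemma near_vertex_of_triangle:
  fixes x y z :: "'a::euclidean_space"
  assumes d: "dist x y \<le> t" "dist y z \<le> t" "dist x z \<le> t" and p: "p \<in> convex hull {x, y, z}"
  shows "\<exists>v\<in>{x, y, z}. 3 * (dist p v)\<^sup>2 \<le> t\<^sup>2"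
proof (rule ccontr)
  assume "\<not> ?thesis"
  then have far: "t\<^sup>2 < 3 * (dist p x)\<^sup>2" "t\<^sup>2 < 3 * (dist p y)\<^sup>2" "t\<^sup>2 < 3 * (dist p z)\<^sup>2" by auto
  obtain a b c where abc: "0 \<le> a" "0 \<le> b" "0 \<le> c" "a + b + c = 1"
    "p = a *\<^sub>R x + b *\<^sub>R y + c *\<^sub>R z"
    using p unfolding convex_hull_3 by auto
  have t: "0 \<le> t" using d(1) zero_le_dist[of x y] by linarith
  have c: "c = 1 - a - b" using abc(4) by simp
  have "a * (dist p x)\<^sup>2 + b * (dist p y)\<^sup>2 + c * (dist p z)\<^sup>2 =
    a * b * (dist x y)\<^sup>2 + b * c * (dist y z)\<^sup>2 + a * c * (dist x z)\<^sup>2"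
    unfolding dist_norm power2_norm_eq_inner abc(5) c
    by (simp add: inner_simps inner_commute algebra_simps)
  also have "\<dots> \<le> a * b * t\<^sup>2 + b * c * t\<^sup>2 + a * c * t\<^sup>2"
    using abc d t by (intro add_mono mult_left_mono power_mono) auto
  also have "\<dots> = (a * b + b * c + a * c) * t\<^sup>2" by (simp add: algebra_simps)
  finally have up: "a * (dist p x)\<^sup>2 + b * (dist p y)\<^sup>2 + c * (dist p z)\<^sup>2 \<le> (a * b + b * c + a * c) * t\<^sup>2" .
  have "3 * (a * b + b * c + a * c) \<le> (a + b + c)\<^sup>2"
    using sum_squares_ge_zero[of "a - b" "b - c"] zero_le_power2[of "a - c"]
    by (simp add: power2_eq_square algebra_simps)
  then have "3 * (a * b + b * c + a * c) * t\<^sup>2 \<le> 1 * t\<^sup>2"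
    using abc(4) by (intro mult_right_mono) auto
  moreover have "t\<^sup>2 < a * (3 * (dist p x)\<^sup>2) + b * (3 * (dist p y)\<^sup>2) + c * (3 * (dist p z)\<^sup>2)"
  proof -
    have "a * t\<^sup>2 \<le> a * (3 * (dist p x)\<^sup>2)" "b * t\<^sup>2 \<le> b * (3 * (dist p y)\<^sup>2)"
      "c * t\<^sup>2 \<le> c * (3 * (dist p z)\<^sup>2)"
      using far abc by (auto intro!: mult_left_mono)
    moreover have "a * t\<^sup>2 < a * (3 * (dist p x)\<^sup>2) \<or> b * t\<^sup>2 < b * (3 * (dist p y)\<^sup>2)
      \<or> c * t\<^sup>2 < c * (3 * (dist p z)\<^sup>2)"
    proof -
      have "a > 0 \<or> b > 0 \<or> c > 0" using abc by linarith
      then show ?thesis using far by (auto intro: mult_strict_left_mono)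
    qed
    moreover have "t\<^sup>2 = a * t\<^sup>2 + b * t\<^sup>2 + c * t\<^sup>2"
      using abc(4) by (metis distrib_right mult_1)
    ultimately show ?thesis by linarith
  qed
  ultimately show False using up by (simp add: algebra_simps)
qed

text \<open>For a path that is not closed the winding number is a complex number, whose real part is the
  change of the argument of \<open>G\<close> in full turns.\<close>
definition angle_increment :: "('a::euclidean_space \<Rightarrow> complex) \<Rightarrow> (real \<Rightarrow> 'a) \<Rightarrow> complex" where
  "angle_increment G p = winding_number (G \<circ> p) 0"

text \<open>The principal logarithms of the values at the endpoints determine the change of angle up to whole turns;
  the remaining integer is the cocycle.\<close>
definition turns :: "('a::euclidean_space \<Rightarrow> complex) \<Rightarrow> 'a \<Rightarrow> 'a \<Rightarrow> int" where
  "turns G x y = (SOME k. angle_increment G (linepath x y) =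
     (Ln (G y) - Ln (G x)) / (2 * pi * \<i>) + of_int k)"

context
  fixes G :: "'a::euclidean_space \<Rightarrow> complex" and U :: "'a set"
  assumes contG: "continuous_on U G" and nz: "\<And>x. x \<in> U \<Longrightarrow> G x \<noteq> 0"
begin

lemma path_G:
  assumes "path p" "path_image p \<subseteq> U"
  shows "path (G \<circ> p)" "0 \<notin> path_image (G \<circ> p)"
proof -
  show "path (G \<circ> p)"
    using assms contG by (intro path_continuous_image) (auto intro: continuous_on_subset)
  show "0 \<notin> path_image (G \<circ> p)"
    using assms nz unfolding path_image_compose by (metis imageE subsetD)
qed

lemma angle_increment_join:
  assumes "path p" "path_image p \<subseteq> U" "path q" "path_image q \<subseteq> U" "pathfinish p = pathstart q"
  shows "angle_increment G (p +++ q) = angle_increment G p + angle_increment G q"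
  unfolding angle_increment_def path_compose_join
  using assms by (intro winding_number_join path_G) (auto simp: pathfinish_compose pathstart_compose)

lemma angle_increment_convex:
  assumes "convex C" "C \<subseteq> U" "path p" "path_image p \<subseteq> C" "path q" "path_image q \<subseteq> C"
    "pathstart q = pathstart p" "pathfinish q = pathfinish p"
  shows "angle_increment G p = angle_increment G q"
proof -
  have "homotopic_paths C p q"
    using convex_imp_simply_connected[OF assms(1)] assms unfolding simply_connected_eq_homotopic_paths by blast
  then have "homotopic_paths (- {0}) (G \<circ> p) (G \<circ> q)"
    by (rule homotopic_paths_continuous_image)
      (use assms(2) nz in \<open>auto intro: continuous_on_subset[OF contG]\<close>)
  then show ?thesis unfolding angle_increment_def by (rule winding_number_homotopic_paths)
qed

lemma angle_increment_turns:
  assumes "closed_segment x y \<subseteq> U"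
  shows "angle_increment G (linepath x y) = (Ln (G y) - Ln (G x)) / (2 * pi * \<i>) + of_int (turns G x y)"
proof -
  have xy: "x \<in> U" "y \<in> U" using assms by auto
  let ?w = "angle_increment G (linepath x y)"
  have "G y - 0 = exp (2 * pi * \<i> * ?w) * (G x - 0)"
    using winding_number_exp_2pi[OF path_G[of "linepath x y"]] assms
    by (simp add: angle_increment_def pathfinish_compose pathstart_compose)
  then have "exp (Ln (G y)) = exp (2 * pi * \<i> * ?w + Ln (G x))"
    using nz xy by (simp add: exp_add)
  then obtain k :: int where "Ln (G y) = 2 * pi * \<i> * ?w + Ln (G x) + 2 * of_int k * pi * \<i>"
    unfolding exp_eq by (auto simp: mult_ac)
  then have "?w = (Ln (G y) - Ln (G x)) / (2 * pi * \<i>) + of_int (- k)"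
    by (simp add: field_simps)
  then show ?thesis unfolding turns_def by (rule someI)
qed

lemma turns_triangle:
  assumes "convex hull {x, y, z} \<subseteq> U"
  shows "turns G x z = turns G x y + turns G y z"
proof -
  let ?C = "convex hull {x, y, z}"
  have seg: "closed_segment a b \<subseteq> ?C" if "a \<in> {x, y, z}" "b \<in> {x, y, z}" for a b
    using that by (intro closed_segment_subset convex_convex_hull) (auto intro: hull_inc)
  have "angle_increment G (linepath x z) = angle_increment G (linepath x y +++ linepath y z)"
    using seg assms by (intro angle_increment_convex[of ?C])
      (auto simp: path_image_join convex_convex_hull)
  also have "\<dots> = angle_increment G (linepath x y) + angle_increment G (linepath y z)"
    using seg[of x y] seg[of y z] assms by (intro angle_increment_join) auto
  finally have "of_int (turns G x z) = (of_int (turns G x y + turns G y z) :: complex)"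
    using seg assms by (subst (asm) (1 2 3) angle_increment_turns) (auto simp: diff_divide_distrib)
  then show ?thesis by (simp only: of_int_eq_iff)
qed

lemma edge_cocycle_turns:
  assumes "\<And>x y z. \<lbrakk>x \<in> P; y \<in> P; z \<in> P; dist x y \<le> t; dist y z \<le> t; dist x z \<le> t\<rbrakk>
      \<Longrightarrow> convex hull {x, y, z} \<subseteq> U"
  shows "edge_cocycle P t (\<lambda>x y. of_int (turns G x y))"
  unfolding edge_cocycle_def of_int_add[symmetric]
proof (intro ballI impI)
  fix x y z
  assume "x \<in> P" "y \<in> P" "z \<in> P" "dist x y \<le> t \<and> dist y z \<le> t \<and> dist x z \<le> t"
  then have "turns G x z = turns G x y + turns G y z" by (intro turns_triangle assms) auto
  then show "of_int (turns G x z) = (of_int (turns G x y + turns G y z) :: bit)" by (rule arg_cong)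
qed

text \<open>Around a closed walk the logarithms cancel, so the turns add up to \<open>k\<close>. A coboundary would add up to
  an even number, since every vertex of the walk is counted twice.\<close>
lemma not_edge_coboundary_turns:
  fixes p :: "nat \<Rightarrow> 'a"
  assumes p: "\<And>i. p i \<in> P" "p N = p 0"
    and seg: "\<And>i. i < N \<Longrightarrow> closed_segment (p i) (p (Suc i)) \<subseteq> U \<and> dist (p i) (p (Suc i)) \<le> s"
    and k: "(\<Sum>i<N. angle_increment G (linepath (p i) (p (Suc i)))) = of_int k" "odd k"
  shows "\<not> edge_coboundary P s (\<lambda>x y. of_int (turns G x y))"
proof
  assume "edge_coboundary P s (\<lambda>x y. of_int (turns G x y))"
  then obtain \<alpha> where \<alpha>: "\<forall>x\<in>P. \<forall>y\<in>P. dist x y \<le> s \<longrightarrow> of_int (turns G x y) = \<alpha> x + (\<alpha> y :: bit)"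
    unfolding edge_coboundary_def by (rule exE)
  have telescope: "(\<Sum>i<N. f (p (Suc i))) = (\<Sum>i<N. f (p i))" for f :: "'a \<Rightarrow> 'c::cancel_comm_monoid_add"
  proof -
    have "(\<Sum>i<N. f (p i)) + f (p N) = f (p 0) + (\<Sum>i<N. f (p (Suc i)))"
      using sum.lessThan_Suc_shift[of "\<lambda>i. f (p i)" N] by (simp only: sum.lessThan_Suc)
    then show ?thesis using p(2) by (simp add: add.commute)
  qed
  let ?l = "\<lambda>x. Ln (G x) / (2 * pi * \<i>)"
  have "of_int k = (\<Sum>i<N. ?l (p (Suc i)) - ?l (p i) + of_int (turns G (p i) (p (Suc i))))"
    unfolding k(1)[symmetric] using seg
    by (intro sum.cong refl) (simp add: angle_increment_turns diff_divide_distrib del: divide_divide_eq_left)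
  also have "\<dots> = (\<Sum>i<N. ?l (p (Suc i))) - (\<Sum>i<N. ?l (p i)) + of_int (\<Sum>i<N. turns G (p i) (p (Suc i)))"
    by (simp add: sum.distrib sum_subtractf)
  also have "(\<Sum>i<N. ?l (p (Suc i))) = (\<Sum>i<N. ?l (p i))" by (rule telescope[of ?l])
  finally have "of_int k = (of_int (\<Sum>i<N. turns G (p i) (p (Suc i))) :: complex)" by simp
  then have "k = (\<Sum>i<N. turns G (p i) (p (Suc i)))" by (simp only: of_int_eq_iff)
  then have "(of_int k :: bit) = (\<Sum>i<N. of_int (turns G (p i) (p (Suc i))))" by simp
  also have "\<dots> = (\<Sum>i<N. \<alpha> (p i) + \<alpha> (p (Suc i)))"
    by (intro sum.cong refl \<alpha>[rule_format]) (use seg p(1) in auto)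
  also have "\<dots> = (\<Sum>i<N. \<alpha> (p i)) + (\<Sum>i<N. \<alpha> (p i))"
    by (simp only: sum.distrib telescope[of \<alpha>])
  also have "\<dots> = 0" by (rule bit_add_self)
  finally have "(of_int k :: bit) = 0" .
  moreover have "(of_int k :: bit) = 1"
  proof -
    obtain j where "k = 2 * j + 1" using k(2) by (elim oddE)
    then show ?thesis by simp
  qed
  ultimately show False by simp
qed

text \<open>The segment between consecutive samples is compared with the piece of \<open>\<gamma>\<close> that it follows
  inside one convex set. The connecting segments from the samples to the curve enter twice with
  opposite signs.\<close>
lemma angle_increment_polygon:
  fixes p :: "nat \<Rightarrow> 'a"
  assumes \<gamma>: "path \<gamma>" "path_image \<gamma> \<subseteq> U" "pathfinish \<gamma> = pathstart \<gamma>" and N: "0 < N" and pN: "p N = p 0"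
    and C: "\<And>i. i < N \<Longrightarrow> convex (C i) \<and> C i \<subseteq> U \<and> p i \<in> C i \<and> p (Suc i) \<in> C i \<and>
       \<gamma> ` {real i / real N .. real (Suc i) / real N} \<subseteq> C i"
  shows "(\<Sum>i<N. angle_increment G (linepath (p i) (p (Suc i)))) = angle_increment G \<gamma>"
proof -
  define v where "v i = real i / real N" for i
  have v: "v i \<in> {0..1}" "v i \<le> v (Suc i)" if "i \<le> N" for i
    using that N by (auto simp: v_def field_simps)
  define c where "c i = angle_increment G (linepath (p i) (\<gamma> (v i)))" for i
  define g where "g i = subpath (v i) (v (Suc i)) \<gamma>" for i
  have step: "angle_increment G (linepath (p i) (p (Suc i))) + c (Suc i) = c i + angle_increment G (g i)"
    if i: "i < N" for i
  proof -
    have \<gamma>C: "\<gamma> ` {v i .. v (Suc i)} \<subseteq> C i" using C[OF i] by (simp add: v_def)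
    have ends: "\<gamma> (v i) \<in> C i" "\<gamma> (v (Suc i)) \<in> C i" using \<gamma>C v(2)[of i] i by auto
    have g: "path (g i)" "path_image (g i) \<subseteq> C i" "pathstart (g i) = \<gamma> (v i)" "pathfinish (g i) = \<gamma> (v (Suc i))"
      using \<gamma>(1) v[of i] v[of "Suc i"] i \<gamma>C by (auto simp: g_def path_image_subpath)
    have seg: "closed_segment a b \<subseteq> C i" if "a \<in> C i" "b \<in> C i" for a b
      using C[OF i] that by (intro closed_segment_subset) auto
    have CU: "C i \<subseteq> U" "convex (C i)" "p i \<in> C i" "p (Suc i) \<in> C i" using C[OF i] by auto
    have "angle_increment G (linepath (p i) (p (Suc i))) + c (Suc i) =
      angle_increment G (linepath (p i) (p (Suc i)) +++ linepath (p (Suc i)) (\<gamma> (v (Suc i))))"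
      unfolding c_def using seg CU ends by (intro angle_increment_join[symmetric]) auto
    also have "\<dots> = angle_increment G (linepath (p i) (\<gamma> (v i)) +++ g i)"
      using seg CU ends g by (intro angle_increment_convex[of "C i"]) (auto simp: path_image_join)
    also have "\<dots> = c i + angle_increment G (g i)"
      unfolding c_def using seg CU ends g by (intro angle_increment_join) auto
    finally show ?thesis .
  qed
  have c_ends: "c N = c 0" using pN \<gamma>(3) N by (simp add: c_def v_def pathstart_def pathfinish_def)
  have pieces: "(\<Sum>i<k. angle_increment G (g i)) = angle_increment G (subpath 0 (v k) \<gamma>)" if "k \<le> N" for k
    using that
  proof (induction k)
    case 0
    have "0 \<noteq> (G \<circ> \<gamma>) 0" using path_G(2)[OF \<gamma>(1,2)] by (metis atLeastAtMost_iff image_eqI order_refl path_image_def zero_le_one)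
    then show ?case by (simp add: angle_increment_def v_def subpath_image[symmetric])
  next
    case (Suc k)
    then have "(\<Sum>i<Suc k. angle_increment G (g i)) =
      winding_number (subpath 0 (v k) (G \<circ> \<gamma>)) 0 + winding_number (subpath (v k) (v (Suc k)) (G \<circ> \<gamma>)) 0"
      by (simp add: angle_increment_def g_def subpath_image)
    also have "\<dots> = winding_number (subpath 0 (v (Suc k)) (G \<circ> \<gamma>)) 0"
      using v[of k] v[of "Suc k"] Suc.prems path_G[OF \<gamma>(1,2)] by (intro winding_number_subpath_combine) auto
    finally show ?case by (simp add: angle_increment_def subpath_image)
  qed
  have "(\<Sum>i<N. angle_increment G (linepath (p i) (p (Suc i)))) + (\<Sum>i<N. c (Suc i)) =
     (\<Sum>i<N. c i) + (\<Sum>i<N. angle_increment G (g i))"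
    using step by (simp flip: sum.distrib)
  moreover have "(\<Sum>i<N. c i) + c N = c 0 + (\<Sum>i<N. c (Suc i))"
    using sum.lessThan_Suc_shift[of c N] by (simp only: sum.lessThan_Suc)
  ultimately have "(\<Sum>i<N. angle_increment G (linepath (p i) (p (Suc i)))) = (\<Sum>i<N. angle_increment G (g i))"
    using c_ends by (simp add: algebra_simps)
  also have "\<dots> = angle_increment G \<gamma>" using pieces[of N] N by (simp add: v_def)
  finally show ?thesis .
qed

end


text \<open>Any homeomorphism to the circle will do: a simple closed path winds around an inside point once in one of
  the two directions.\<close>
lemma simple_loop_circle_map:
  fixes \<gamma> :: "real \<Rightarrow> 'a::euclidean_space"
  assumes "simple_path \<gamma>" "pathfinish \<gamma> = pathstart \<gamma>"
  obtains h :: "'a \<Rightarrow> complex" where "continuous_on (path_image \<gamma>) h"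
    "\<And>x. x \<in> path_image \<gamma> \<Longrightarrow> norm (h x) = 1"
    "\<exists>k. odd k \<and> winding_number (h \<circ> \<gamma>) 0 = of_int k"
proof -
  have "path_image \<gamma> homeomorphic sphere (0::complex) 1"
    using homeomorphic_simple_path_image_circle[OF assms, of 1 0] by simp
  then obtain h g where hom: "homeomorphism (path_image \<gamma>) (sphere (0::complex) 1) h g"
    unfolding homeomorphic_def by blast
  have h: "continuous_on (path_image \<gamma>) h" "h ` path_image \<gamma> = sphere 0 1" "inj_on h (path_image \<gamma>)"
    using hom by (auto simp: homeomorphism_def intro: inj_on_inverseI)
  have simple: "simple_path (h \<circ> \<gamma>)"
    by (rule simple_path_continuous_image[OF assms(1) h(1,3)])
  have "inside (path_image (h \<circ> \<gamma>)) = ball 0 1"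
    using inside_frontier_eq_interior[of "cball (0::complex) 1"] h(2) by (simp add: path_image_compose)
  then have "winding_number (h \<circ> \<gamma>) 0 = 1 \<or> winding_number (h \<circ> \<gamma>) 0 = - 1"
    by (rule_tac simple_closed_path_winding_number_inside[OF simple]) auto
  then have "\<exists>k. odd k \<and> winding_number (h \<circ> \<gamma>) 0 = of_int k"
    by (metis odd_one even_minus of_int_1 of_int_minus)
  then show ?thesis using that[of h] h(1,2) by (force simp: sphere_def dist_norm)
qed

text \<open>The surviving class is the curve itself. Up to scale \<open>t < sqrt 3 * R\<close> triangles stay in the
  domain of the nearest-point projection, so the turns form a cocycle; samples along the curve form a
  closed walk with steps at most \<open>s > 2 * \<delta>\<close> that winds an odd number of times.\<close>
lemma survives_curve_sample:
  fixes \<gamma> :: "real \<Rightarrow> 'a::euclidean_space"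
  assumes simple: "simple_path \<gamma>" and loop: "pathfinish \<gamma> = pathstart \<gamma>"
    and uniq: "\<And>x. infdist x (path_image \<gamma>) < R \<Longrightarrow>
      \<exists>!y. y \<in> path_image \<gamma> \<and> dist x y = infdist x (path_image \<gamma>)"
    and P: "P \<subseteq> path_image \<gamma>" "\<And>m. m \<in> path_image \<gamma> \<Longrightarrow> \<exists>p\<in>P. dist m p \<le> \<delta>"
    and scales: "\<delta> < R" "2 * \<delta> < s" "t\<^sup>2 < 3 * R\<^sup>2"
  shows "survives P s t"
proof -
  let ?M = "path_image \<gamma>"
  define U where "U = {x. infdist x ?M < R}"
  have path: "path \<gamma>" using simple by (rule simple_path_imp_path)
  have start: "\<gamma> 0 \<in> ?M" by (simp add: path_image_def)
  then have "0 \<le> \<delta>" using P(2) zero_le_dist by (metis order_trans)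
  then have R: "0 < R" using scales by simp
  obtain \<pi> where \<pi>: "continuous_on U \<pi>" "\<And>x. x \<in> U \<Longrightarrow> \<pi> x \<in> ?M" "\<And>x. x \<in> ?M \<Longrightarrow> \<pi> x = x"
    using continuous_on_nearest_point[OF compact_path_image[OF path] uniq] R unfolding U_def
    by (metis infdist_zero mem_Collect_eq)
  obtain h :: "'a \<Rightarrow> complex" and k where h: "continuous_on ?M h" "\<And>x. x \<in> ?M \<Longrightarrow> norm (h x) = 1"
    and k: "odd k" "winding_number (h \<circ> \<gamma>) 0 = of_int k"
    using simple_loop_circle_map[OF simple loop] by metis
  define G where "G = h \<circ> \<pi>"
  have contG: "continuous_on U G"
    unfolding G_def using \<pi> h by (intro continuous_on_compose) (auto intro: continuous_on_subset)
  have nz: "G x \<noteq> 0" if "x \<in> U" for x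
    using h(2)[OF \<pi>(2)[OF that]] by (auto simp: G_def)
  have MU: "?M \<subseteq> U" using R by (auto simp: U_def)
  have ball_U: "ball m R \<subseteq> U" if "m \<in> ?M" for m
  proof
    fix x assume "x \<in> ball m R"
    then show "x \<in> U" using infdist_le[OF that, of x] by (simp add: U_def dist_commute)
  qed
  have "edge_cocycle P t (\<lambda>x y. of_int (turns G x y))"
  proof (rule edge_cocycle_turns[OF contG nz])
    fix x y z assume xyz: "x \<in> P" "y \<in> P" "z \<in> P" "dist x y \<le> t" "dist y z \<le> t" "dist x z \<le> t"
    show "convex hull {x, y, z} \<subseteq> U"
    proof
      fix p assume "p \<in> convex hull {x, y, z}"
      then obtain v where v: "v \<in> {x, y, z}" "3 * (dist p v)\<^sup>2 \<le> t\<^sup>2"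
        using near_vertex_of_triangle[OF xyz(4-6)] by blast
      then have "(dist p v)\<^sup>2 < R\<^sup>2" using scales by linarith
      then have "dist v p < R" using R by (simp add: power2_less_imp_less dist_commute)
      moreover have "v \<in> ?M" using v xyz P by auto
      ultimately show "p \<in> U" using ball_U[of v] by auto
    qed
  qed
  moreover have "\<not> edge_coboundary P s (\<lambda>x y. of_int (turns G x y))"
  proof -
    \<comment> \<open>\<open>e\<close> is the mesh along the curve: small enough for consecutive samples to be joined by an edge at
      scale \<open>s\<close>, and for all of one piece to lie in a ball of radius \<open>R\<close> around a point of the curve.\<close>
    define e where "e = min ((R - \<delta>) / 2) (s - 2 * \<delta>)"
    have e: "0 < e" "\<delta> + e < R" "2 * \<delta> + e \<le> s" using scales by (auto simp: e_def min_def field_simps)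
    have "uniformly_continuous_on {0..1} \<gamma>"
      using path unfolding path_def by (intro compact_uniformly_continuous) auto
    then obtain d where d: "0 < d" "\<And>u v. u \<in> {0..1} \<Longrightarrow> v \<in> {0..1} \<Longrightarrow> dist u v < d \<Longrightarrow> dist (\<gamma> u) (\<gamma> v) < e"
      using e(1) unfolding uniformly_continuous_on_def by (metis dist_commute)
    obtain N :: nat where N: "0 < N" "1 / real N < d"
      using d(1) real_arch_inverse[of d] by (auto simp: inverse_eq_divide)
    obtain pick where pick: "\<And>m. m \<in> ?M \<Longrightarrow> pick m \<in> P \<and> dist m (pick m) \<le> \<delta>"
      using P(2) by metis
    \<comment> \<open>Clamping the index keeps \<open>p i\<close> a sample point for all \<open>i\<close>.\<close>
    define v where "v i = real (min i N) / real N" for i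
    define p where "p i = pick (\<gamma> (v i))" for i
    have v: "v i \<in> {0..1}" for i using N by (auto simp: v_def field_simps)
    have \<gamma>v: "\<gamma> (v i) \<in> ?M" for i using v by (auto simp: path_image_def)
    have p: "p i \<in> P" "dist (\<gamma> (v i)) (p i) \<le> \<delta>" for i
      using pick[OF \<gamma>v] by (auto simp: p_def)
    have pN: "p N = p 0" using loop N by (simp add: p_def v_def pathstart_def pathfinish_def)
    have near: "dist (\<gamma> (v i)) (\<gamma> u) < e" if "i < N" "u \<in> {real i / real N .. real (Suc i) / real N}" for i u
    proof (rule d(2)[OF v])
      have "real (Suc i) / real N \<le> 1" "0 \<le> real i / real N" using that N by auto
      then show "u \<in> {0..1}" using that(2) unfolding atLeastAtMost_iff by linarith
      have "real (Suc i) / real N = real i / real N + 1 / real N" by (simp add: add_divide_distrib)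
      then show "dist (v i) u < d" using that N by (auto simp: v_def dist_real_def)
    qed
    have next_near: "dist (\<gamma> (v i)) (\<gamma> (v (Suc i))) < e" if "i < N" for i
      using near[OF that, of "v (Suc i)"] that N by (auto simp: v_def divide_right_mono)
    have p_next: "dist (\<gamma> (v i)) (p (Suc i)) \<le> \<delta> + e" if "i < N" for i
      using next_near[OF that] p(2)[of "Suc i"] dist_triangle[of "\<gamma> (v i)" "p (Suc i)" "\<gamma> (v (Suc i))"]
      by linarith
    have in_ball: "p i \<in> ball (\<gamma> (v i)) R" "p (Suc i) \<in> ball (\<gamma> (v i)) R" if "i < N" for i
      using p(2)[of i] p_next[OF that] e scales by auto
    show ?thesis
    proof (rule not_edge_coboundary_turns[OF contG nz p(1) pN])
      fix i assume i: "i < N"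
      have "closed_segment (p i) (p (Suc i)) \<subseteq> ball (\<gamma> (v i)) R"
        using in_ball[OF i] by (intro closed_segment_subset) auto
      moreover have "dist (p i) (p (Suc i)) \<le> s"
        using p(2)[of i] p_next[OF i] dist_triangle2[of "p i" "p (Suc i)" "\<gamma> (v i)"] e(3)
        by (simp add: dist_commute)
      ultimately show "closed_segment (p i) (p (Suc i)) \<subseteq> U \<and> dist (p i) (p (Suc i)) \<le> s"
        using ball_U[OF \<gamma>v] by blast
    next
      have "(\<Sum>i<N. angle_increment G (linepath (p i) (p (Suc i)))) = angle_increment G \<gamma>"
      proof (rule angle_increment_polygon[OF contG nz path MU loop N(1) pN, where C = "\<lambda>i. ball (\<gamma> (v i)) R"])
        fix i assume i: "i < N"
        have "\<gamma> ` {real i / real N..real (Suc i) / real N} \<subseteq> ball (\<gamma> (v i)) R"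
        proof (intro image_subsetI)
          fix u assume "u \<in> {real i / real N..real (Suc i) / real N}"
          from near[OF i this] show "\<gamma> u \<in> ball (\<gamma> (v i)) R"
            using e \<open>0 \<le> \<delta>\<close> by simp
        qed
        then show "convex (ball (\<gamma> (v i)) R) \<and> ball (\<gamma> (v i)) R \<subseteq> U \<and> p i \<in> ball (\<gamma> (v i)) R \<and>
          p (Suc i) \<in> ball (\<gamma> (v i)) R \<and> \<gamma> ` {real i / real N..real (Suc i) / real N} \<subseteq> ball (\<gamma> (v i)) R"
          using ball_U[OF \<gamma>v] in_ball[OF i] by blast
      qed
      also have "\<dots> = winding_number (h \<circ> \<gamma>) 0"
        unfolding angle_increment_def
      proof (rule winding_number_cong)
        fix u :: real assume "0 \<le> u" "u \<le> 1"
        then have "\<gamma> u \<in> ?M" by (auto simp: path_image_def)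
        then show "(G \<circ> \<gamma>) u = (h \<circ> \<gamma>) u" using \<pi>(3) by (simp add: G_def)
      qed
      also have "\<dots> = of_int k" by (rule k(2))
      finally show "(\<Sum>i<N. angle_increment G (linepath (p i) (p (Suc i)))) = of_int k" .
      show "odd k" by (rule k(1))
    qed
  qed
  ultimately show ?thesis unfolding survives_def by blast
qed

section \<open>Gaussian noise and delay vectors\<close>

text \<open>Completing the square, that is, the exponential change of measure behind the Chernoff
  bound.\<close>
lemma normal_density_shift:
  assumes "0 < s"
  shows "exp (u * (x - u) / s\<^sup>2) * normal_density 0 s x =
    exp (- u\<^sup>2 / (2 * s\<^sup>2)) * normal_density u s x"
proof -
  have "u * (x - u) / s\<^sup>2 + - x\<^sup>2 / (2 * s\<^sup>2) = - u\<^sup>2 / (2 * s\<^sup>2) + - (x - u)\<^sup>2 / (2 * s\<^sup>2)"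
    using assms by (simp add: field_simps power2_eq_square)
  then have "exp (u * (x - u) / s\<^sup>2) * exp (- x\<^sup>2 / (2 * s\<^sup>2)) =
    exp (- u\<^sup>2 / (2 * s\<^sup>2)) * exp (- (x - u)\<^sup>2 / (2 * s\<^sup>2))"
    by (simp only: exp_add[symmetric])
  then show ?thesis by (simp add: normal_density_def)
qed

lemma normal_density_le_shifted:
  assumes "0 < s" "0 \<le> u * (x - u)"
  shows "normal_density 0 s x \<le> exp (- u\<^sup>2 / (2 * s\<^sup>2)) * normal_density u s x"
proof -
  have "1 * normal_density 0 s x \<le> exp (u * (x - u) / s\<^sup>2) * normal_density 0 s x"
    using assms by (intro mult_right_mono) auto
  then show ?thesis using normal_density_shift[OF assms(1)] by simp
qed

lemma nn_integral_normal_density: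
  assumes "0 < s"
  shows "(\<integral>\<^sup>+ x. ennreal (normal_density m s x) \<partial>lborel) = 1"
proof -
  interpret prob_space "density lborel (normal_density m s)"
    by (rule prob_space_normal_density[OF assms])
  show ?thesis using emeasure_space_1 by (simp add: emeasure_density)
qed

text \<open>Beyond \<open>\<plusminus>u\<close> the centred density is bounded by a multiple of the density centred at
  \<open>\<plusminus>u\<close>, which integrates to one.\<close>
lemma normal_tail:
  assumes "0 < s" "0 \<le> u"
  shows "measure (density lborel (\<lambda>x. ennreal (normal_density 0 s x))) {x. u < \<bar>x\<bar>}
    \<le> 2 * exp (- u\<^sup>2 / (2 * s\<^sup>2))"
proof -
  let ?c = "exp (- u\<^sup>2 / (2 * s\<^sup>2))"
  have "emeasure (density lborel (\<lambda>x. ennreal (normal_density 0 s x))) {x. u < \<bar>x\<bar>} =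
    (\<integral>\<^sup>+ x. ennreal (normal_density 0 s x) * indicator {x. u < \<bar>x\<bar>} x \<partial>lborel)"
    by (intro emeasure_density) auto
  also have "\<dots> \<le> (\<integral>\<^sup>+ x. ennreal ?c * (ennreal (normal_density u s x) + ennreal (normal_density (- u) s x)) \<partial>lborel)"
  proof (intro nn_integral_mono)
    fix x :: real
    have "normal_density 0 s x \<le> ?c * (normal_density u s x + normal_density (- u) s x)" if "u < \<bar>x\<bar>"
    proof (cases "0 \<le> x")
      case True
      then have "normal_density 0 s x \<le> ?c * normal_density u s x"
        using that assms by (intro normal_density_le_shifted) auto
      also have "\<dots> \<le> ?c * (normal_density u s x + normal_density (- u) s x)" by (intro mult_left_mono) auto
      finally show ?thesis .
    next
      case False
      then have "0 \<le> (- u) * (x - (- u))"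
        using that assms(2) by (intro mult_nonpos_nonpos) auto
      then have "normal_density 0 s x \<le> ?c * normal_density (- u) s x"
        using normal_density_le_shifted[of s "- u" x] assms by simp
      also have "\<dots> \<le> ?c * (normal_density u s x + normal_density (- u) s x)" by (intro mult_left_mono) auto
      finally show ?thesis .
    qed
    then show "ennreal (normal_density 0 s x) * indicator {x. u < \<bar>x\<bar>} x \<le>
      ennreal ?c * (ennreal (normal_density u s x) + ennreal (normal_density (- u) s x))"
      by (auto simp: indicator_def simp flip: ennreal_plus ennreal_mult intro!: ennreal_leI)
  qed
  also have "\<dots> = ennreal ?c * (1 + 1)"
    by (simp add: nn_integral_cmult nn_integral_add nn_integral_normal_density assms(1))
  also have "\<dots> = ennreal (2 * ?c)"
    by (simp add: ennreal_mult mult.commute one_add_one)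
  finally show ?thesis unfolding measure_def by (intro enn2real_leI) auto
qed

text \<open>The threshold is chosen such that the tail bound takes the form \<open>2 / c\<close>. For \<open>s = 0\<close> the law
  is the point mass at \<open>0\<close> and the threshold is \<open>0\<close>, so the tail is empty.\<close>
lemma centered_normal_tail:
  assumes "0 \<le> s" "1 \<le> c"
  shows "measure (centered_normal s) {x. s * sqrt (2 * ln c) < \<bar>x\<bar>} \<le> 2 / c"
proof (cases "s = 0")
  case True
  then show ?thesis using assms by (simp add: centered_normal_def measure_return)
next
  case False
  then have s: "0 < s" using assms by simp
  let ?u = "s * sqrt (2 * ln c)"
  have l: "0 \<le> ln c" using assms by simp
  have "- ?u\<^sup>2 / (2 * s\<^sup>2) = - ln c"
    using s l by (simp add: power_mult_distrib)
  moreover have "measure (centered_normal s) {x. ?u < \<bar>x\<bar>} \<le> 2 * exp (- ?u\<^sup>2 / (2 * s\<^sup>2))"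
    using normal_tail[OF s, of ?u] s l by (simp add: centered_normal_def)
  moreover have "exp (- ln c) = 1 / c" using assms by (simp add: exp_minus inverse_eq_divide)
  ultimately show ?thesis by simp
qed

text \<open>A union bound over the \<open>n\<close> observations, each exceeding the threshold with probability at most
  \<open>\<gamma> / n\<close>.\<close>
lemma max_noise_bound:
  fixes \<xi> :: "nat \<Rightarrow> 'w \<Rightarrow> real"
  assumes "prob_space \<Omega>" and n: "1 \<le> n" and s: "0 \<le> s" and \<gamma>: "0 < \<gamma>" "\<gamma> < 1"
    and \<xi>: "\<And>k. k \<in> {1..n} \<Longrightarrow> \<xi> k \<in> borel_measurable \<Omega>"
      "\<And>k. k \<in> {1..n} \<Longrightarrow> distr \<Omega> borel (\<xi> k) = centered_normal s"
  defines "t \<equiv> s * sqrt (2 * ln (2 * real n / \<gamma>))"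
  shows "{w \<in> space \<Omega>. \<forall>k\<in>{1..n}. \<bar>\<xi> k w\<bar> \<le> t} \<in> sets \<Omega>"
    and "1 - \<gamma> \<le> measure \<Omega> {w \<in> space \<Omega>. \<forall>k\<in>{1..n}. \<bar>\<xi> k w\<bar> \<le> t}"
proof -
  interpret prob_space \<Omega> by fact
  let ?B = "\<lambda>k. {w \<in> space \<Omega>. t < \<bar>\<xi> k w\<bar>}"
  have B: "?B k \<in> sets \<Omega>" if "k \<in> {1..n}" for k
    using \<xi>(1)[OF that] by measurable
  have E: "{w \<in> space \<Omega>. \<forall>k\<in>{1..n}. \<bar>\<xi> k w\<bar> \<le> t} = space \<Omega> - (\<Union>k\<in>{1..n}. ?B k)" by (auto simp: not_le[symmetric])
  have U: "(\<Union>k\<in>{1..n}. ?B k) \<in> sets \<Omega>" using B by (intro sets.finite_UN) auto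
  then show "{w \<in> space \<Omega>. \<forall>k\<in>{1..n}. \<bar>\<xi> k w\<bar> \<le> t} \<in> sets \<Omega>" unfolding E by auto
  have "measure \<Omega> (?B k) \<le> \<gamma> / real n" if k: "k \<in> {1..n}" for k
  proof -
    have "\<gamma> \<le> 2 * real n" using n \<gamma> by linarith
    then have "measure (centered_normal s) {x. t < \<bar>x\<bar>} \<le> 2 / (2 * real n / \<gamma>)"
      unfolding t_def using s \<gamma> by (intro centered_normal_tail) auto
    moreover have "measure (distr \<Omega> borel (\<xi> k)) {x. t < \<bar>x\<bar>} = measure \<Omega> (?B k)"
      by (subst measure_distr[OF \<xi>(1)[OF k]]) (auto intro!: arg_cong[where f = "measure \<Omega>"])
    ultimately show ?thesis using \<xi>(2)[OF k] by simp
  qed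
  then have "(\<Sum>k\<in>{1..n}. measure \<Omega> (?B k)) \<le> (\<Sum>k\<in>{1..n}. \<gamma> / real n)" by (intro sum_mono)
  also have "\<dots> = \<gamma>" using n by simp
  finally have sum: "(\<Sum>k\<in>{1..n}. measure \<Omega> (?B k)) \<le> \<gamma>" .
  have "measure \<Omega> (\<Union>k\<in>{1..n}. ?B k) \<le> (\<Sum>k\<in>{1..n}. measure \<Omega> (?B k))"
    using B by (intro finite_measure_subadditive_finite) auto
  with sum have "measure \<Omega> (\<Union>k\<in>{1..n}. ?B k) \<le> \<gamma>" by linarith
  then show "1 - \<gamma> \<le> measure \<Omega> {w \<in> space \<Omega>. \<forall>k\<in>{1..n}. \<bar>\<xi> k w\<bar> \<le> t}"
    unfolding E using prob_compl[OF U] by simp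
qed

text \<open>Compactness makes the suprema bounded and the infima attained.\<close>
lemma hausdorff_dist_le_iff:
  fixes A B :: "'a::heine_borel set"
  assumes "compact A" "compact B" "A \<noteq> {}" "B \<noteq> {}"
  shows "hausdorff_dist A B \<le> r \<longleftrightarrow>
    (\<forall>a\<in>A. \<exists>b\<in>B. dist a b \<le> r) \<and> (\<forall>b\<in>B. \<exists>a\<in>A. dist b a \<le> r)"
proof -
  have half: "(SUP a\<in>A. infdist a B) \<le> r \<longleftrightarrow> (\<forall>a\<in>A. \<exists>b\<in>B. dist a b \<le> r)"
    if AB: "compact A" "compact B" "A \<noteq> {}" "B \<noteq> {}" for A B :: "'a set"
  proof -
    have "bdd_above ((\<lambda>a. infdist a B) ` A)"
      using AB(1) by (intro bounded_imp_bdd_above compact_imp_bounded compact_continuous_image)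
        (auto intro!: continuous_intros)
    then have "(SUP a\<in>A. infdist a B) \<le> r \<longleftrightarrow> (\<forall>a\<in>A. infdist a B \<le> r)"
      using AB by (intro cSUP_le_iff) auto
    also have "\<dots> \<longleftrightarrow> (\<forall>a\<in>A. \<exists>b\<in>B. dist a b \<le> r)"
    proof (intro ball_cong refl iffI)
      fix a assume "infdist a B \<le> r"
      then show "\<exists>b\<in>B. dist a b \<le> r"
        using infdist_attains_inf[OF compact_imp_closed[OF AB(2)] AB(4), of a] by metis
    next
      fix a assume "\<exists>b\<in>B. dist a b \<le> r"
      then show "infdist a B \<le> r" by (auto intro: infdist_le2)
    qed
    finally show ?thesis .
  qed
  show ?thesis unfolding hausdorff_dist_def using half[of A B] half[of B A] assms by simp
qed

lemma coord_index_le: "coord_index (i :: 'm::{finite,linorder}) \<le> CARD('m) - 1"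
proof -
  have "card {j. j < i} < CARD('m)" by (intro psubset_card_mono) auto
  then show ?thesis by (simp add: coord_index_def)
qed

lemma delayed_index_range:
  assumes "k \<in> {(CARD('m::{finite,linorder}) - 1) * L + 1 .. n}"
  shows "k - coord_index (i :: 'm) * L \<in> {1..n}"
proof -
  have "coord_index i * L \<le> (CARD('m) - 1) * L" using coord_index_le by (rule mult_right_mono) simp
  then show ?thesis using assms unfolding atLeastAtMost_iff by linarith
qed

lemma dist_delay_vector_le:
  assumes "k \<in> {(CARD('m::{finite,linorder}) - 1) * L + 1 .. n}" "0 \<le> r"
    and "\<And>j. j \<in> {1..n} \<Longrightarrow> \<bar>y j - x j\<bar> \<le> r"
  shows "dist (delay_vector L y k :: real^'m::{finite,linorder}) (delay_vector L x k) \<le> sqrt (real CARD('m)) * r"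
proof -
  have "dist (delay_vector L y k :: real^'m::{finite,linorder}) (delay_vector L x k) =
    L2_set (\<lambda>i. \<bar>y (k - coord_index i * L) - x (k - coord_index i * L)\<bar>) (UNIV :: 'm set)"
    by (simp add: dist_vec_def delay_vector_def dist_real_def)
  also have "\<dots> \<le> L2_set (\<lambda>i. r) (UNIV :: 'm set)"
    using assms(3) delayed_index_range[OF assms(1)] by (intro L2_set_mono) auto
  also have "\<dots> = sqrt (real CARD('m)) * r" using assms(2) by (simp add: L2_set_constant)
  finally show ?thesis .
qed

lemma measurable_delay_vector:
  fixes \<xi> :: "nat \<Rightarrow> 'w \<Rightarrow> real"
  assumes "k \<in> {(CARD('m::{finite,linorder}) - 1) * L + 1 .. n}"
    and "\<And>j. j \<in> {1..n} \<Longrightarrow> \<xi> j \<in> borel_measurable \<Omega>"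
  shows "(\<lambda>w. delay_vector L (\<lambda>j. x j + \<xi> j w) k :: real^'m::{finite,linorder}) \<in> borel_measurable \<Omega>"
proof -
  have "(\<lambda>w. x (k - coord_index i * L) + \<xi> (k - coord_index i * L) w) \<in> borel_measurable \<Omega>" for i :: 'm
    using assms(2)[OF delayed_index_range[OF assms(1), of i]] by simp
  then show ?thesis
    by (subst borel_measurable_euclidean_space)
      (auto simp: Basis_vec_def delay_vector_def inner_axis)
qed

lemma measurable_hausdorff_dist_le:
  fixes p :: "'i \<Rightarrow> 'w \<Rightarrow> 'a::euclidean_space"
  assumes A: "finite A" "A \<noteq> {}" and I: "finite I" "I \<noteq> {}"
    and p: "\<And>i. i \<in> I \<Longrightarrow> p i \<in> borel_measurable \<Omega>"
  shows "{w \<in> space \<Omega>. hausdorff_dist A ((\<lambda>i. p i w) ` I) \<le> r} \<in> sets \<Omega>"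
proof -
  have [measurable]: "\<And>i. i \<in> I \<Longrightarrow> p i \<in> borel_measurable \<Omega>" by fact
  have "{w \<in> space \<Omega>. hausdorff_dist A ((\<lambda>i. p i w) ` I) \<le> r} =
    {w \<in> space \<Omega>. (\<forall>a\<in>A. \<exists>i\<in>I. dist a (p i w) \<le> r) \<and> (\<forall>i\<in>I. \<exists>a\<in>A. dist (p i w) a \<le> r)}"
    using A I by (subst hausdorff_dist_le_iff) (auto simp: finite_imp_compact)
  also have "\<dots> \<in> sets \<Omega>"
    using A(1) I(1)
    by (intro sets.sets_Collect_conj sets.sets_Collect_finite_All sets.sets_Collect_finite_Ex) measurable
  finally show ?thesis .
qed

lemma unique_nearest_point_below_reach:
  assumes "infdist x K < enn2real (reach K)"
  shows "\<exists>!y. y \<in> K \<and> dist x y = infdist x K"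
proof -
  have "reach K \<noteq> \<top>" using assms infdist_nonneg[of x K] by auto
  then have "ennreal (infdist x K) < reach K"
    using assms by (metis ennreal_enn2real ennreal_lessI enn2real_nonneg infdist_nonneg le_less_trans
        less_top order_le_less)
  then obtain r where "0 < r" "\<forall>x. infdist x K < r \<longrightarrow> (\<exists>!y. y \<in> K \<and> dist x y = infdist x K)"
    "ennreal (infdist x K) < ennreal r"
    unfolding reach_def less_SUP_iff by auto
  then show ?thesis using infdist_nonneg[of x K] by (simp add: ennreal_less_iff)
qed

text \<open>The solution over one minimal period, rescaled to the unit interval; times outside are
  reduced modulo the period.\<close>
lemma periodic_orbit_loop:
  fixes \<Phi> :: "'a::euclidean_space \<Rightarrow> 'b::euclidean_space"
  assumes "periodic_orbit g \<Gamma>" "continuous_on \<Gamma> \<Phi>" "inj_on \<Phi> \<Gamma>"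
  obtains \<gamma> where "simple_path \<gamma>" "pathfinish \<gamma> = pathstart \<gamma>" "path_image \<gamma> = \<Phi> ` \<Gamma>"
proof -
  obtain x T where x: "0 < T" "is_solution g x UNIV" "\<And>t. x (t + T) = x t" "inj_on x {0..<T}" "\<Gamma> = range x"
    using assms(1) unfolding periodic_orbit_def by blast
  have contx: "continuous_on UNIV x"
    using x(2) unfolding is_solution_def
    by (auto intro!: continuous_at_imp_continuous_on has_vector_derivative_continuous)
  interpret periodic_fun_simple x T by unfold_locales (rule x(3))
  have wrap: "\<exists>r\<in>{0..<1}. x t = x (T * r)" for t
  proof
    have "x t = x ((t - of_int \<lfloor>t / T\<rfloor> * T) + of_int \<lfloor>t / T\<rfloor> * T)" by simp
    also have "\<dots> = x (t - of_int \<lfloor>t / T\<rfloor> * T)" by (rule plus_of_int)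
    also have "t - of_int \<lfloor>t / T\<rfloor> * T = T * frac (t / T)"
      using x(1) by (simp add: frac_def field_simps)
    finally show "x t = x (T * frac (t / T))" .
    show "frac (t / T) \<in> {0..<1}" using frac_lt_1 by auto
  qed
  define \<gamma> where "\<gamma> = (\<lambda>r. \<Phi> (x (T * r)))"
  have "path \<gamma>" unfolding path_def \<gamma>_def
    by (rule continuous_on_compose2[OF assms(2)])
      (auto simp: x(5) intro!: continuous_on_compose2[OF contx] continuous_intros)
  moreover have "loop_free \<gamma>"
    unfolding loop_free_def
  proof (intro ballI impI)
    fix u v :: real assume uv: "u \<in> {0..1}" "v \<in> {0..1}" "\<gamma> u = \<gamma> v"
    \<comment> \<open>The endpoint \<open>1\<close> is identified with \<open>0\<close> to bring injectivity on \<open>{0..<T}\<close> to bear.\<close>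
    define wrp where "wrp r = (if r = 1 then 0 else r)" for r :: real
    have wrp: "T * wrp r \<in> {0..<T}" "x (T * wrp r) = x (T * r)" if "r \<in> {0..1}" for r
      using that x(1) x(3)[of 0] by (auto simp: wrp_def)
    have "x (T * u) = x (T * v)" using uv(3) assms(3) by (auto simp: \<gamma>_def x(5) dest: inj_onD)
    then have "x (T * wrp u) = x (T * wrp v)" using wrp(2) uv(1,2) by simp
    then have "T * wrp u = T * wrp v" using wrp(1)[OF uv(1)] wrp(1)[OF uv(2)] by (rule inj_onD[OF x(4)])
    then show "u = v \<or> u = 0 \<and> v = 1 \<or> u = 1 \<and> v = 0" using x(1) by (auto simp: wrp_def split: if_splits)
  qed
  moreover have "pathfinish \<gamma> = pathstart \<gamma>"
    using x(3)[of 0] by (simp add: pathfinish_def pathstart_def \<gamma>_def)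
  moreover have "path_image \<gamma> = \<Phi> ` \<Gamma>"
  proof
    show "path_image \<gamma> \<subseteq> \<Phi> ` \<Gamma>" by (auto simp: path_image_def \<gamma>_def x(5))
    show "\<Phi> ` \<Gamma> \<subseteq> path_image \<gamma>"
    proof
      fix y assume "y \<in> \<Phi> ` \<Gamma>"
      then obtain t where "y = \<Phi> (x t)" by (auto simp: x(5))
      then show "y \<in> path_image \<gamma>" using wrap[of t] by (auto simp: path_image_def \<gamma>_def)
    qed
  qed
  ultimately show ?thesis using that[of \<gamma>] by (simp add: simple_path_def)
qed

section \<open>Noisy reconstructions across the bifurcation\<close>

theorem corollary2:
  fixes f :: "real^'n \<Rightarrow> real \<Rightarrow> real^'n"
    and \<mu>\<^sub>c :: real and J :: "real set"
    and xs :: "real \<Rightarrow> real^'n" and \<Gamma> :: "real \<Rightarrow> (real^'n) set"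
    and obs :: "real^'n \<Rightarrow> real" and \<tau> :: real
    and P :: "real \<Rightarrow> (real^'m::{finite,linorder}) set" and \<delta> :: "real \<Rightarrow> real"
    and A :: "real \<Rightarrow> (real^'n) set" and \<Phi> :: "real \<Rightarrow> real^'n \<Rightarrow> real^'m::{finite,linorder}"
    and M :: "real \<Rightarrow> (real^'m::{finite,linorder}) set" and R \<eta> :: "real \<Rightarrow> real"
    and \<mu> :: real
    and u :: "real \<Rightarrow> real^'n" and t\<^sub>0 h :: real and L n :: nat and x :: "nat \<Rightarrow> real"
    and X\<^sub>0 :: "(real^'m::{finite,linorder}) set" and a s :: real
    and \<Omega> :: "'w measure" and \<xi> :: "nat \<Rightarrow> 'w \<Rightarrow> real"
    and X :: "'w \<Rightarrow> (real^'m::{finite,linorder}) set" and q H :: "'w \<Rightarrow> real"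
    and \<gamma> t Q :: real
  assumes hopf: "supercritical_hopf f \<mu>\<^sub>c J xs \<Gamma>"
  defines "A \<equiv> \<lambda>\<mu>. if \<mu> < \<mu>\<^sub>c then {xs \<mu>} else \<Gamma> \<mu>"
    and "\<Phi> \<equiv> \<lambda>\<mu>. delay_map (\<lambda>y. f y \<mu>) obs \<tau>"
    and "M \<equiv> \<lambda>\<mu>. \<Phi> \<mu> ` A \<mu>"
    and "R \<equiv> \<lambda>\<mu>. enn2real (reach (M \<mu>))"
    and "\<eta> \<equiv> \<lambda>\<mu>. 2 * (sqrt (3 / 10) * R \<mu> - 2 * \<delta> \<mu>)"
  assumes tau: "\<tau> > 0"
    and embedding: "\<forall>\<mu>\<in>J. \<mu> \<noteq> \<mu>\<^sub>c \<longrightarrow> takens_embedding (\<lambda>y. f y \<mu>) (\<Phi> \<mu>) (A \<mu>)"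
    and sample_above: "\<forall>\<mu>\<in>J. \<mu> > \<mu>\<^sub>c \<longrightarrow>
          finite (P \<mu>) \<and> P \<mu> \<noteq> {} \<and> P \<mu> \<subseteq> M \<mu> \<and> hausdorff_dist (P \<mu>) (M \<mu>) \<le> \<delta> \<mu> \<and>
          reach (M \<mu>) > 0 \<and> \<delta> \<mu> < 1 / 2 * sqrt (3 / 10) * R \<mu>"
    and sample_below: "\<forall>\<mu>\<in>J. \<mu> < \<mu>\<^sub>c \<longrightarrow> P \<mu> = M \<mu>"
    and parameter: "\<mu> \<in> J" "\<mu> \<noteq> \<mu>\<^sub>c"
    and sampling: "h > 0" "\<tau> = real L * h" "(CARD('m) - 1) * L < n"
    and trajectory: "is_solution (\<lambda>y. f y \<mu>) u {t\<^sub>0 + h .. t\<^sub>0 + real n * h}"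
    and observations: "\<forall>k\<in>{1..n}. x k = obs (u (t\<^sub>0 + real k * h))"
  defines "X\<^sub>0 \<equiv> delay_cloud L n x"
  assumes noise_free: "a \<ge> 0" "hausdorff_dist (P \<mu>) X\<^sub>0 \<le> a"
    and prob: "prob_space \<Omega>"
    and indep: "prob_space.indep_vars \<Omega> (\<lambda>_. borel) \<xi> {1..n}"
    and gauss: "s \<ge> 0" "\<forall>k\<in>{1..n}. distr \<Omega> borel (\<xi> k) = centered_normal s"
  defines "X \<equiv> \<lambda>w. delay_cloud L n (\<lambda>k. x k + \<xi> k w)"
    and "q \<equiv> \<lambda>w. hausdorff_dist (P \<mu>) (X w)"
    and "H \<equiv> \<lambda>w. dominant_persistence (X w)"
  assumes gamma: "0 < \<gamma>" "\<gamma> < 1"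
  defines "t \<equiv> s * sqrt (2 * ln (2 * real n / \<gamma>))"
    and "Q \<equiv> a + sqrt (real CARD('m)) * s * sqrt (2 * ln (2 * real n / \<gamma>))"
  shows "measure \<Omega> {w \<in> space \<Omega>. Max ((\<lambda>k. \<bar>\<xi> k w\<bar>) ` {1..n}) \<le> t} \<ge> 1 - \<gamma>
    \<and> measure \<Omega> {w \<in> space \<Omega>. q w \<le> Q} \<ge> 1 - \<gamma>
    \<and> (\<mu> < \<mu>\<^sub>c \<longrightarrow> measure \<Omega> {w \<in> space \<Omega>. H w \<le> 4 * Q} \<ge> 1 - \<gamma>)
    \<and> (\<mu> > \<mu>\<^sub>c \<longrightarrow> measure \<Omega> {w \<in> space \<Omega>. H w \<ge> \<eta> \<mu> - 4 * Q} \<ge> 1 - \<gamma>)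
    \<and> (\<mu> > \<mu>\<^sub>c \<and> \<eta> \<mu> > 4 * Q \<longrightarrow>
         \<eta> \<mu> - 4 * Q > 0 \<and>
         measure \<Omega> {w \<in> space \<Omega>. \<exists>(b, d)\<in>set_mset (persistence_diagram 1 (X w)).
            d - b \<ge> \<eta> \<mu> - 4 * Q} \<ge> 1 - \<gamma>)"
proof -
  interpret prob_space \<Omega> by (rule prob)
  define I where "I = {(CARD('m) - 1) * L + 1 .. n}"
  define p :: "nat \<Rightarrow> 'w \<Rightarrow> real^'m::{finite,linorder}" where "p i w = delay_vector L (\<lambda>k. x k + \<xi> k w) i" for i w
  define E where "E = {w \<in> space \<Omega>. \<forall>k\<in>{1..n}. \<bar>\<xi> k w\<bar> \<le> t}"
  define c where "c = \<eta> \<mu> - 4 * Q"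
  have n: "1 \<le> n" using sampling(3) by linarith
  have I: "finite I" "I \<noteq> {}" using sampling(3) by (auto simp: I_def)
  have X: "X w = (\<lambda>i. p i w) ` I" for w by (simp add: X_def delay_cloud_def p_def I_def)
  have finX: "finite (X w)" "X w \<noteq> {}" for w using I by (auto simp: X)
  have X0: "finite X\<^sub>0" "X\<^sub>0 \<noteq> {}" using I by (auto simp: X\<^sub>0_def delay_cloud_def I_def)
  have \<xi>: "\<xi> k \<in> borel_measurable \<Omega>" if "k \<in> {1..n}" for k
    using indep that unfolding indep_vars_def by blast
  have p: "p i \<in> borel_measurable \<Omega>" if "i \<in> I" for i
    using measurable_delay_vector[OF that[unfolded I_def] \<xi>] unfolding p_def .
  have t0: "0 \<le> t"
  proof -
    have "\<gamma> \<le> 2 * real n" using n gamma by linarith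
    then have "1 \<le> 2 * real n / \<gamma>" using gamma by (simp add: le_divide_eq)
    then show ?thesis unfolding t_def by (intro mult_nonneg_nonneg gauss(1) real_sqrt_ge_zero ln_ge_zero) simp
  qed
  have Q: "Q = a + sqrt (real CARD('m)) * t" by (simp add: Q_def t_def)
  have Q0: "0 \<le> Q" using noise_free(1) t0 by (simp add: Q)
  have E: "E \<in> sets \<Omega>" "1 - \<gamma> \<le> measure \<Omega> E"
    unfolding E_def t_def by (intro max_noise_bound prob n gauss(1) gamma \<xi> gauss(2)[rule_format]; assumption)+
  \<comment> \<open>All conclusions hold on \<open>E\<close>; only measurability remains to be checked for each.\<close>
  have likely: "1 - \<gamma> \<le> measure \<Omega> {w \<in> space \<Omega>. B w}"
    if "{w \<in> space \<Omega>. B w} \<in> sets \<Omega>" "\<And>w. w \<in> E \<Longrightarrow> B w" for B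
  proof -
    have "measure \<Omega> E \<le> measure \<Omega> {w \<in> space \<Omega>. B w}"
      using that by (intro finite_measure_mono) (auto simp: E_def)
    with E(2) show ?thesis by linarith
  qed
  have max: "Max ((\<lambda>k. \<bar>\<xi> k w\<bar>) ` {1..n}) \<le> t \<longleftrightarrow> (\<forall>k\<in>{1..n}. \<bar>\<xi> k w\<bar> \<le> t)" for w
    using n by (subst Max_le_iff) auto
  have P: "finite (P \<mu>)" "P \<mu> \<noteq> {}"
  proof -
    have "P \<mu> = {\<Phi> \<mu> (xs \<mu>)}" if "\<mu> < \<mu>\<^sub>c"
      using sample_below parameter(1) that by (simp add: M_def A_def)
    moreover have "finite (P \<mu>) \<and> P \<mu> \<noteq> {}" if "\<mu> > \<mu>\<^sub>c"
      using sample_above parameter(1) that by blast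
    ultimately show "finite (P \<mu>)" "P \<mu> \<noteq> {}" using parameter(2) by (cases "\<mu> < \<mu>\<^sub>c"; simp)+
  qed
  have close: "(\<forall>y\<in>P \<mu>. \<exists>z\<in>X w. dist y z \<le> Q) \<and> (\<forall>z\<in>X w. \<exists>y\<in>P \<mu>. dist z y \<le> Q)"
    if w: "w \<in> E" for w
  proof -
    have move: "dist (p i w) (delay_vector L x i) \<le> sqrt (real CARD('m)) * t" if "i \<in> I" for i
      unfolding p_def using w that t0 by (intro dist_delay_vector_le) (auto simp: E_def I_def)
    have PX0: "(\<forall>y\<in>P \<mu>. \<exists>z\<in>X\<^sub>0. dist y z \<le> a) \<and> (\<forall>z\<in>X\<^sub>0. \<exists>y\<in>P \<mu>. dist z y \<le> a)"
      using noise_free(2)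
      unfolding hausdorff_dist_le_iff[OF finite_imp_compact[OF P(1)] finite_imp_compact[OF X0(1)] P(2) X0(2)] .
    show ?thesis
    proof (intro conjI ballI)
      fix y assume "y \<in> P \<mu>"
      then obtain i where i: "i \<in> I" "dist y (delay_vector L x i) \<le> a"
        using PX0 unfolding X\<^sub>0_def delay_cloud_def I_def by blast
      then have "dist y (p i w) \<le> Q"
        using move[OF i(1)] dist_triangle2[of y "p i w" "delay_vector L x i"] unfolding Q by linarith
      then show "\<exists>z\<in>X w. dist y z \<le> Q" using i(1) by (auto simp: X)
    next
      fix z assume "z \<in> X w"
      then obtain i where i: "i \<in> I" "z = p i w" by (auto simp: X)
      then obtain y where y: "y \<in> P \<mu>" "dist (delay_vector L x i) y \<le> a"
        using PX0 unfolding X\<^sub>0_def delay_cloud_def I_def by blast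
      then have "dist z y \<le> Q"
        using move[OF i(1)] dist_triangle[of z y "delay_vector L x i"] unfolding Q i(2) by linarith
      then show "\<exists>y\<in>P \<mu>. dist z y \<le> Q" using y(1) by blast
    qed
  qed
  have Hm [measurable]: "H \<in> borel_measurable \<Omega>"
    unfolding H_def X by (intro borel_measurable_dominant_persistence I p)

  have "measure \<Omega> {w \<in> space \<Omega>. Max ((\<lambda>k. \<bar>\<xi> k w\<bar>) ` {1..n}) \<le> t} \<ge> 1 - \<gamma>"
    unfolding max using E(2) by (simp add: E_def)
  moreover have "measure \<Omega> {w \<in> space \<Omega>. q w \<le> Q} \<ge> 1 - \<gamma>"
  proof (rule likely)
    show "{w \<in> space \<Omega>. q w \<le> Q} \<in> sets \<Omega>"
      unfolding q_def X by (intro measurable_hausdorff_dist_le P I p)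
    show "q w \<le> Q" if "w \<in> E" for w
      unfolding q_def hausdorff_dist_le_iff[OF finite_imp_compact[OF P(1)] finite_imp_compact[OF finX(1)] P(2) finX(2)]
      by (rule close[OF that])
  qed
  moreover have "measure \<Omega> {w \<in> space \<Omega>. H w \<le> 4 * Q} \<ge> 1 - \<gamma>" if below: "\<mu> < \<mu>\<^sub>c"
  proof (rule likely)
    show "{w \<in> space \<Omega>. H w \<le> 4 * Q} \<in> sets \<Omega>" by measurable
    fix w assume w: "w \<in> E"
    have point: "P \<mu> = {\<Phi> \<mu> (xs \<mu>)}"
      using sample_below parameter(1) below by (simp add: M_def A_def)
    show "H w \<le> 4 * Q"
    proof (rule ccontr)
      assume "\<not> H w \<le> 4 * Q"
      then have "4 * Q < dominant_persistence (X w)" by (simp add: H_def)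
      then obtain s' t' where st: "s' \<le> t'" "4 * Q \<le> t' - s'" "survives (X w) s' t'"
        using survives_of_less_dominant_persistence[OF finX(1)] Q0
        by (metis mult_nonneg_nonneg zero_le_numeral)
      have "survives (P \<mu>) (s' + 2 * Q) (t' - 2 * Q)"
        by (rule survives_perturb[OF st(3)]) (use close[OF w] st(2) Q0 in auto)
      moreover have "0 \<le> s'" using st(3) not_survives_negative[of s' "X w" t'] by linarith
      ultimately show False
        using not_survives_diameter[of "P \<mu>" "t' - 2 * Q" "s' + 2 * Q"] st(2) Q0 unfolding point by simp
    qed
  qed
  moreover have bound: "c \<le> H w" if above: "\<mu> > \<mu>\<^sub>c" and w: "w \<in> E" for w
  proof (cases "0 \<le> c")
    case False
    then show ?thesis using dominant_persistence_nonneg[OF finX(1), of w] by (simp add: H_def)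
  next
    case True
    have sample: "P \<mu> \<subseteq> M \<mu>" "hausdorff_dist (P \<mu>) (M \<mu>) \<le> \<delta> \<mu>"
      "\<delta> \<mu> < 1 / 2 * sqrt (3 / 10) * R \<mu>"
      using sample_above parameter(1) above by auto
    have A: "A \<mu> = \<Gamma> \<mu>" using above by (simp add: A_def)
    have "takens_embedding (\<lambda>y. f y \<mu>) (\<Phi> \<mu>) (\<Gamma> \<mu>)"
      using embedding[rule_format, OF parameter] unfolding A .
    then obtain \<Psi> where "homeomorphism (\<Gamma> \<mu>) (\<Phi> \<mu> ` \<Gamma> \<mu>) (\<Phi> \<mu>) \<Psi>"
      unfolding takens_embedding_def by (elim conjE exE)
    then have emb: "continuous_on (\<Gamma> \<mu>) (\<Phi> \<mu>)" "inj_on (\<Phi> \<mu>) (\<Gamma> \<mu>)"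
      by (auto simp: homeomorphism_def intro: inj_on_inverseI)
    have "\<forall>\<mu>\<in>J. \<mu> > \<mu>\<^sub>c \<longrightarrow>
        periodic_orbit (\<lambda>y. f y \<mu>) (\<Gamma> \<mu>) \<and> asymptotically_stable (\<lambda>y. f y \<mu>) (\<Gamma> \<mu>)"
      using hopf unfolding supercritical_hopf_def by (elim conjE)
    then have "periodic_orbit (\<lambda>y. f y \<mu>) (\<Gamma> \<mu>)" using parameter(1) above by simp
    then obtain \<gamma>' where \<gamma>': "simple_path \<gamma>'" "pathfinish \<gamma>' = pathstart \<gamma>'"
        "path_image \<gamma>' = \<Phi> \<mu> ` \<Gamma> \<mu>"
      using emb by (rule periodic_orbit_loop)
    have M\<gamma>: "path_image \<gamma>' = M \<mu>" unfolding \<gamma>'(3) M_def A ..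
    have M: "compact (M \<mu>)" "M \<mu> \<noteq> {}"
      unfolding M\<gamma>[symmetric] using \<gamma>'(1) by (auto simp: compact_simple_path_image)
    have PM: "\<exists>y\<in>P \<mu>. dist z y \<le> \<delta> \<mu>" if "z \<in> M \<mu>" for z
      using sample(2) that
      unfolding hausdorff_dist_le_iff[OF finite_imp_compact[OF P(1)] M(1) P(2) M(2)] by blast
    obtain z0 where "z0 \<in> M \<mu>" using M(2) by blast
    with PM obtain y0 where "dist z0 y0 \<le> \<delta> \<mu>" by blast
    then have \<delta>0: "0 \<le> \<delta> \<mu>" using zero_le_dist[of z0 y0] by linarith
    have sqrt: "0 < sqrt (3 / 10)" "sqrt (3 / 10) \<le> 7 / 10"
      by (simp, rule real_le_lsqrt) (simp_all add: power2_eq_square)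
    have R: "0 < R \<mu>"
    proof (rule ccontr)
      assume "\<not> 0 < R \<mu>"
      then have "sqrt (3 / 10) * R \<mu> \<le> 0" using sqrt(1) by (simp add: mult_nonneg_nonpos)
      then show False using sample(3) \<delta>0 by simp
    qed
    have sR: "sqrt (3 / 10) * R \<mu> \<le> 7 / 10 * R \<mu>" using sqrt(2) R by (intro mult_right_mono) auto
    \<comment> \<open>Any \<open>?s > 2 * \<delta>\<close> and \<open>?t < sqrt 3 * R\<close> with \<open>?t - ?s \<ge> \<eta>\<close> would serve.\<close>
    let ?s = "2 * \<delta> \<mu> + 3 / 10 * R \<mu>" and ?t = "17 / 10 * R \<mu>"
    have "2 * (z - 2 * d) - 4 * r + 4 * r \<le> 17 / 10 * e - (2 * d + 3 / 10 * e)"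
      if "z \<le> 7 / 10 * e" "0 \<le> d" for z d r e :: real using that by (simp add: field_simps)
    from this[OF sR \<delta>0] have c\<eta>: "c + 4 * Q \<le> ?t - ?s" unfolding c_def \<eta>_def .
    have "survives (P \<mu>) ?s ?t"
    proof (rule survives_curve_sample[OF \<gamma>'(1,2)])
      show "\<exists>!y. y \<in> path_image \<gamma>' \<and> dist z y = infdist z (path_image \<gamma>')"
        if "infdist z (path_image \<gamma>') < R \<mu>" for z
        using that unfolding M\<gamma> R_def by (rule unique_nearest_point_below_reach)
      show "\<delta> \<mu> < R \<mu>"
      proof -
        have "2 * \<delta> \<mu> < sqrt (3 / 10) * R \<mu>" using sample(3) by simp
        with sR R show ?thesis by linarith
      qed
      show "2 * \<delta> \<mu> < ?s" using R by simp
      show "?t\<^sup>2 < 3 * (R \<mu>)\<^sup>2" using R by (simp add: power2_eq_square)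
      show "P \<mu> \<subseteq> path_image \<gamma>'" unfolding M\<gamma> by (rule sample(1))
      show "\<exists>y\<in>P \<mu>. dist z y \<le> \<delta> \<mu>" if "z \<in> path_image \<gamma>'" for z
        using that unfolding M\<gamma> by (rule PM)
    qed
    then have "survives (X w) (?s + 2 * Q) (?t - 2 * Q)"
    proof (rule survives_perturb)
      show "?s + 4 * Q \<le> ?t" using c\<eta> True by linarith
    qed (use close[OF w] Q0 in auto)
    then have "c < dominant_persistence (X w)"
    proof (rule less_dominant_persistence_of_survives[OF finX(1) True])
      show "?s + 2 * Q \<le> ?t - 2 * Q" using c\<eta> True by linarith
      show "c \<le> ?t - 2 * Q - (?s + 2 * Q)" using c\<eta> by linarith
    qed
    then show ?thesis by (simp add: H_def)
  qed
  have lower: "measure \<Omega> {w \<in> space \<Omega>. H w \<ge> c} \<ge> 1 - \<gamma>" if "\<mu> > \<mu>\<^sub>c"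
  proof (rule likely)
    show "{w \<in> space \<Omega>. H w \<ge> c} \<in> sets \<Omega>" by measurable
  qed (rule bound[OF that])
  moreover have "measure \<Omega> {w \<in> space \<Omega>. \<exists>(b, d)\<in>set_mset (persistence_diagram 1 (X w)). d - b \<ge> c} \<ge> 1 - \<gamma>"
    if "\<mu> > \<mu>\<^sub>c" "c > 0"
    using lower[OF that(1)] le_dominant_persistence_iff[OF finX(1) that(2)] by (simp add: H_def)
  ultimately show ?thesis unfolding c_def by auto
qed

end
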